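(* Let $(D,V)$ be a Dyer system. Then the growth series of $D$ with respect to $V$ is rational, i.e. there exist polynomials $p(t),q(t)$ with integer coefficients, $q\neq 0$, such that $\mathcal{G}_{(D,V)}(t)=\frac{p(t)}{q(t)}$.
   Context: A Dyer graph is a triple $(\Gamma,m,f)$ where $\Gamma$ is a finite simple graph with vertex set $V=V(\Gamma)$ and edge set $E(\Gamma)$ (edges are 2-element subsets of $V$), and $f\colon V\to\mathbb{N}_{\geq 2}\cup\{\infty\}$, $m\colon E(\Gamma)\to\mathbb{N}_{\geq 2}$ are maps such that for every edge $e=\{x,y\}$ with $m(e)\neq 2$ one has $f(x)=f(y)=2$. For letters $a,b$ and $n\in\mathbb{N}$ let $\pi(a,b,n)=abab\ldots$ be the alternating word of length $n$ starting with $a$. The associated Dyer group is $$D=\langle V\mid x^{f(x)}=1 \text{ for } x\in V \text{ with } f(x)\neq\infty,\ \pi(x,y,m(\{x,y\}))=\pi(y,x,m(\{x,y\})) \text{ for } \{x,y\}\in E(\Gamma)\rangle,$$ and $(D,V)$ is the associated Dyer system. For a group $G$ with finite generating set $S$, $l_S(g)$ is the word length of $g$ in the alphabet $S\cup S^{-1}$, and the growth series is the formal power series $\mathcal{G}_{(G,S)}(t)=\sum_{g\in G}t^{l_S(g)}\in\mathbb{Z}[[t]]$. *)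

theory Defs
  imports
    "HOL-Algebra.Generated_Groups"
    "HOL-Computational_Algebra.Polynomial_FPS"
    "HOL-Computational_Algebra.Polynomial_Factorial"
    "HOL-Library.Extended_Nat"
begin

section \<open>Groups given by generators and relations\<close>

text \<open>
  A group word over \<open>X\<close> is a list of signed letters: \<open>(x, True)\<close> stands for \<open>x\<close> and
  \<open>(x, False)\<close> for the formal inverse of \<open>x\<close>.  A relation \<open>r = s\<close> is a pair \<open>(r, s)\<close> of words.
\<close>

type_synonym 'a gword = "('a \<times> bool) list"

definition gwords :: "'a set \<Rightarrow> 'a gword set" where
  "gwords X = lists (X \<times> UNIV)"

text \<open>
  The presented group is the free monoid on \<open>X\<close> and its formal inverses, modulo the
  congruence generated by the free cancellations and the relations in \<open>R\<close>.
\<close>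

inductive_set pres_rel :: "'a set \<Rightarrow> ('a gword \<times> 'a gword) set \<Rightarrow> ('a gword \<times> 'a gword) set"
  for X :: "'a set" and R :: "('a gword \<times> 'a gword) set" where
  refl: "w \<in> gwords X \<Longrightarrow> (w, w) \<in> pres_rel X R"
| sym: "(v, w) \<in> pres_rel X R \<Longrightarrow> (w, v) \<in> pres_rel X R"
| trans: "(u, v) \<in> pres_rel X R \<Longrightarrow> (v, w) \<in> pres_rel X R \<Longrightarrow> (u, w) \<in> pres_rel X R"
| cancel: "x \<in> X \<Longrightarrow> u \<in> gwords X \<Longrightarrow> v \<in> gwords X \<Longrightarrow>
    (u @ [(x, b), (x, \<not> b)] @ v, u @ v) \<in> pres_rel X R"
| relation: "(r, s) \<in> R \<Longrightarrow> r \<in> gwords X \<Longrightarrow> s \<in> gwords X \<Longrightarrow> u \<in> gwords X \<Longrightarrow> v \<in> gwords X \<Longrightarrow>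
    (u @ r @ v, u @ s @ v) \<in> pres_rel X R"

definition presented_group :: "'a set \<Rightarrow> ('a gword \<times> 'a gword) set \<Rightarrow> 'a gword set monoid" where
  "presented_group X R =
    \<lparr> carrier = gwords X // pres_rel X R,
      monoid.mult = (\<lambda>A B. \<Union>u\<in>A. \<Union>v\<in>B. pres_rel X R `` {u @ v}),
      one = pres_rel X R `` {[]} \<rparr>"

definition pres_gens :: "'a set \<Rightarrow> ('a gword \<times> 'a gword) set \<Rightarrow> 'a gword set set" where
  "pres_gens X R = (\<lambda>x. pres_rel X R `` {[(x, True)]}) ` X"

lemma gwords_Nil [simp]: "[] \<in> gwords X"
  and gwords_Cons [simp]: "(a # w \<in> gwords X) = (fst a \<in> X \<and> w \<in> gwords X)"
  and gwords_append [simp]: "(u @ v \<in> gwords X) = (u \<in> gwords X \<and> v \<in> gwords X)"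
  by (cases a; auto simp: gwords_def)+

lemma pres_rel_gwords: "(u, v) \<in> pres_rel X R \<Longrightarrow> u \<in> gwords X \<and> v \<in> gwords X"
  by (induction rule: pres_rel.induct) auto

lemma equiv_pres_rel: "equiv (gwords X) (pres_rel X R)"
  by (intro equivI refl_onI symI transI)
    (auto dest: pres_rel_gwords intro: pres_rel.refl pres_rel.sym pres_rel.trans)

lemma pres_rel_context:
  assumes "(v, w) \<in> pres_rel X R" "a \<in> gwords X" "b \<in> gwords X"
  shows "(a @ v @ b, a @ w @ b) \<in> pres_rel X R"
  using assms(1)
proof induction
  case (cancel x u v c)
  then show ?case
    using pres_rel.cancel[of x X "a @ u" "v @ b" c R] assms by simp
next
  case (relation r s u v)
  then show ?case
    using pres_rel.relation[of r s R X "a @ u" "v @ b"] assms by simp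
qed (use assms in \<open>auto intro: pres_rel.refl pres_rel.sym pres_rel.trans\<close>)

lemma pres_rel_append:
  assumes "(u, u') \<in> pres_rel X R" "(v, v') \<in> pres_rel X R"
  shows "(u @ v, u' @ v') \<in> pres_rel X R"
  using pres_rel_context[OF assms(1), of "[]" v] pres_rel_context[OF assms(2), of u' "[]"]
    pres_rel_gwords[OF assms(1)] pres_rel_gwords[OF assms(2)]
  by (auto intro: pres_rel.trans)

lemma presented_group_mult:
  assumes "u \<in> gwords X" "v \<in> gwords X"
  shows "pres_rel X R `` {u} \<otimes>\<^bsub>presented_group X R\<^esub> pres_rel X R `` {v} = pres_rel X R `` {u @ v}"
proof -
  have "congruent2 (pres_rel X R) (pres_rel X R) (\<lambda>u v. pres_rel X R `` {u @ v})"
    by (auto intro!: congruent2I' equiv_class_eq[OF equiv_pres_rel] pres_rel_append)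
  from UN_equiv_class2[OF equiv_pres_rel equiv_pres_rel this assms]
  show ?thesis by (simp add: presented_group_def)
qed

lemma presented_group_carrier:
  "g \<in> carrier (presented_group X R) \<longleftrightarrow> (\<exists>w\<in>gwords X. g = pres_rel X R `` {w})"
  by (auto simp: presented_group_def quotient_def)

lemma pres_class_carrier:
  "w \<in> gwords X \<Longrightarrow> pres_rel X R `` {w} \<in> carrier (presented_group X R)"
  unfolding presented_group_carrier by blast

lemma presented_group_one: "\<one>\<^bsub>presented_group X R\<^esub> = pres_rel X R `` {[]}"
  by (simp add: presented_group_def)

lemma pres_rel_inverse:
  "w \<in> gwords X \<Longrightarrow> (rev (map (apsnd Not) w) @ w, []) \<in> pres_rel X R \<and> rev (map (apsnd Not) w) \<in> gwords X"
proof (induction w)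
  case (Cons a w)
  obtain x b where a: "a = (x, b)" by force
  let ?i = "rev (map (apsnd Not) w)"
  have "(?i @ [(x, \<not> b), (x, \<not> \<not> b)] @ w, ?i @ w) \<in> pres_rel X R"
    using Cons a by (intro pres_rel.cancel) auto
  then show ?case using Cons a by (auto intro: pres_rel.trans)
qed (auto intro: pres_rel.refl)

lemma group_presented_group: "group (presented_group X R)"
proof (rule groupI)
  fix g assume "g \<in> carrier (presented_group X R)"
  then obtain w where w: "w \<in> gwords X" "g = pres_rel X R `` {w}"
    by (auto simp: presented_group_carrier)
  show "\<one>\<^bsub>presented_group X R\<^esub> \<otimes>\<^bsub>presented_group X R\<^esub> g = g"
    using w by (simp add: presented_group_mult presented_group_one)
  have "pres_rel X R `` {rev (map (apsnd Not) w)} \<otimes>\<^bsub>presented_group X R\<^esub> g = \<one>\<^bsub>presented_group X R\<^esub>"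
    using w pres_rel_inverse[OF w(1), of R]
    by (simp add: presented_group_mult presented_group_one equiv_class_eq[OF equiv_pres_rel])
  then show "\<exists>h\<in>carrier (presented_group X R). h \<otimes>\<^bsub>presented_group X R\<^esub> g = \<one>\<^bsub>presented_group X R\<^esub>"
    using pres_rel_inverse[OF w(1), of R]
    by (intro bexI[of _ "pres_rel X R `` {rev (map (apsnd Not) w)}"])
      (simp_all add: pres_class_carrier)
next
  show "\<one>\<^bsub>presented_group X R\<^esub> \<in> carrier (presented_group X R)"
    unfolding presented_group_carrier presented_group_one by (rule bexI[of _ "[]"]) auto
next
  fix g h assume "g \<in> carrier (presented_group X R)" "h \<in> carrier (presented_group X R)"
  then obtain u v where "u \<in> gwords X" "g = pres_rel X R `` {u}" "v \<in> gwords X" "h = pres_rel X R `` {v}"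
    unfolding presented_group_carrier by blast
  then show "g \<otimes>\<^bsub>presented_group X R\<^esub> h \<in> carrier (presented_group X R)"
    unfolding presented_group_carrier by (intro bexI[of _ "u @ v"]) (simp_all add: presented_group_mult)
next
  fix g h k
  assume "g \<in> carrier (presented_group X R)" "h \<in> carrier (presented_group X R)"
    "k \<in> carrier (presented_group X R)"
  then obtain u v w where "u \<in> gwords X" "g = pres_rel X R `` {u}" "v \<in> gwords X" "h = pres_rel X R `` {v}"
    "w \<in> gwords X" "k = pres_rel X R `` {w}"
    unfolding presented_group_carrier by blast
  then show "g \<otimes>\<^bsub>presented_group X R\<^esub> h \<otimes>\<^bsub>presented_group X R\<^esub> k =
      g \<otimes>\<^bsub>presented_group X R\<^esub> (h \<otimes>\<^bsub>presented_group X R\<^esub> k)"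
    by (simp add: presented_group_mult)
qed

lemma pres_gens_carrier: "pres_gens X R \<subseteq> carrier (presented_group X R)"
  unfolding pres_gens_def by (auto intro!: pres_class_carrier)

lemma generate_pres_gens: "generate (presented_group X R) (pres_gens X R) = carrier (presented_group X R)"
proof
  interpret group "presented_group X R" by (rule group_presented_group)
  show "generate (presented_group X R) (pres_gens X R) \<subseteq> carrier (presented_group X R)"
    by (rule generate_incl[OF pres_gens_carrier])
  have "pres_rel X R `` {w} \<in> generate (presented_group X R) (pres_gens X R)" if "w \<in> gwords X" for w
    using that
  proof (induction w)
    case Nil
    then show ?case using generate.one[of "presented_group X R"] by (simp add: presented_group_one)
  next
    case (Cons a w)
    obtain x b where a: "a = (x, b)" by force
    let ?c = "\<lambda>b. pres_rel X R `` {[(x, b)]}"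
    have x: "x \<in> X" and gx: "?c True \<in> pres_gens X R"
      using Cons a by (auto simp: pres_gens_def)
    have "([(x, False), (x, True)], []) \<in> pres_rel X R"
      using pres_rel.cancel[of x X "[]" "[]" False R] x by simp
    then have "?c False \<otimes>\<^bsub>presented_group X R\<^esub> ?c True = \<one>\<^bsub>presented_group X R\<^esub>"
      using x by (simp add: presented_group_mult presented_group_one equiv_class_eq[OF equiv_pres_rel])
    then have "inv\<^bsub>presented_group X R\<^esub> ?c True = ?c False"
      using x by (intro inv_equality) (auto intro!: pres_class_carrier)
    then have "?c b \<in> generate (presented_group X R) (pres_gens X R)"
      using generate.incl[OF gx] generate.inv[OF gx, of "presented_group X R"] by (cases b) auto
    from generate.eng[OF this Cons.IH] Cons a show ?case
      by (simp add: presented_group_mult)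
  qed
  then show "carrier (presented_group X R) \<subseteq> generate (presented_group X R) (pres_gens X R)"
    by (auto simp: presented_group_carrier)
qed

section \<open>Word length and growth series\<close>

text \<open>
  Only meaningful when \<open>S\<close> generates \<open>G\<close>; otherwise the \<open>LEAST\<close> ranges over an empty set for
  the elements that are not products of generators.
\<close>

definition word_length :: "('g, 'm) monoid_scheme \<Rightarrow> 'g set \<Rightarrow> 'g \<Rightarrow> nat" where
  "word_length G S g = (LEAST n. \<exists>ws. set ws \<subseteq> S \<union> m_inv G ` S \<and> length ws = n \<and>
     foldr (\<otimes>\<^bsub>G\<^esub>) ws \<one>\<^bsub>G\<^esub> = g)"

definition growth_series :: "('g, 'm) monoid_scheme \<Rightarrow> 'g set \<Rightarrow> int fps" where
  "growth_series G S = Abs_fps (\<lambda>n. int (card {g \<in> carrier G. word_length G S g = n}))"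

text \<open>The sets counted by the growth series are finite when \<open>S\<close> is a finite generating set.\<close>

lemma (in group) word_length_witness:
  assumes "S \<subseteq> carrier G" "g \<in> generate G S"
  shows "\<exists>ws. set ws \<subseteq> S \<union> m_inv G ` S \<and> length ws = word_length G S g \<and> foldr (\<otimes>) ws \<one> = g"
proof -
  have foldr_closed: "foldr (\<otimes>) vs \<one> \<in> carrier G" if "set vs \<subseteq> S \<union> m_inv G ` S" for vs
    using that assms(1) by (induction vs) auto
  have foldr_append: "foldr (\<otimes>) (us @ vs) \<one> = foldr (\<otimes>) us \<one> \<otimes> foldr (\<otimes>) vs \<one>"
    if "set us \<subseteq> S \<union> m_inv G ` S" "set vs \<subseteq> S \<union> m_inv G ` S" for us vs
    using that(1)
  proof (induction us)
    case Nil
    then show ?case using foldr_closed[OF that(2)] by simp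
  next
    case (Cons a us)
    then have "a \<in> carrier G" using assms(1) by auto
    then show ?case
      using Cons foldr_closed[OF that(2)] foldr_closed[of us] by (simp add: m_assoc)
  qed
  have "\<exists>ws. set ws \<subseteq> S \<union> m_inv G ` S \<and> foldr (\<otimes>) ws \<one> = g"
    using assms(2)
  proof induction
    case one
    show ?case by (rule exI[of _ "[]"]) simp
  next
    case (incl h)
    then show ?case using assms(1) by (intro exI[of _ "[h]"]) auto
  next
    case (inv h)
    then show ?case using assms(1) by (intro exI[of _ "[inv h]"]) auto
  next
    case (eng h1 h2)
    then obtain us vs where
      us: "set us \<subseteq> S \<union> m_inv G ` S" "foldr (\<otimes>) us \<one> = h1" and
      vs: "set vs \<subseteq> S \<union> m_inv G ` S" "foldr (\<otimes>) vs \<one> = h2" by blast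
    show ?case
      using us vs foldr_append[OF us(1) vs(1)] by (intro exI[of _ "us @ vs"]) auto
  qed
  then have "\<exists>n ws. set ws \<subseteq> S \<union> m_inv G ` S \<and> length ws = n \<and> foldr (\<otimes>) ws \<one> = g"
    by blast
  from LeastI_ex[OF this] show ?thesis unfolding word_length_def by blast
qed

lemma (in group) finite_word_length_sphere:
  assumes "finite S" "S \<subseteq> carrier G" "generate G S = carrier G"
  shows "finite {g \<in> carrier G. word_length G S g = n}"
proof (rule finite_surj)
  show "finite {ws. set ws \<subseteq> S \<union> m_inv G ` S \<and> length ws = n}"
    using assms(1) by (intro finite_lists_length_eq) auto
  show "{g \<in> carrier G. word_length G S g = n} \<subseteq>
    (\<lambda>ws. foldr (\<otimes>) ws \<one>) ` {ws. set ws \<subseteq> S \<union> m_inv G ` S \<and> length ws = n}"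
  proof
    fix g assume g: "g \<in> {g \<in> carrier G. word_length G S g = n}"
    then have "g \<in> generate G S" using assms(3) by simp
    from word_length_witness[OF assms(2) this] g
    show "g \<in> (\<lambda>ws. foldr (\<otimes>) ws \<one>) ` {ws. set ws \<subseteq> S \<union> m_inv G ` S \<and> length ws = n}"
      by blast
  qed
qed

section \<open>Dyer graphs and Dyer groups\<close>

text \<open>The values of \<open>m\<close> outside \<open>E\<close> and of \<open>f\<close> outside \<open>V\<close> are irrelevant.\<close>

locale dyer_graph =
  fixes V :: "'a set" and E :: "'a set set" and m :: "'a set \<Rightarrow> nat" and f :: "'a \<Rightarrow> enat"
  assumes finite_V: "finite V"
    and edge: "e \<in> E \<Longrightarrow> e \<subseteq> V \<and> card e = 2"
    and f_ge_2: "x \<in> V \<Longrightarrow> 2 \<le> f x"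
    and m_ge_2: "e \<in> E \<Longrightarrow> 2 \<le> m e"
    and m_neq_2: "{x, y} \<in> E \<Longrightarrow> m {x, y} \<noteq> 2 \<Longrightarrow> f x = 2 \<and> f y = 2"

primrec alt_word :: "'a \<Rightarrow> 'a \<Rightarrow> nat \<Rightarrow> 'a gword" where
  "alt_word a b 0 = []"
| "alt_word a b (Suc n) = (a, True) # alt_word b a n"

definition dyer_relations ::
    "'a set \<Rightarrow> 'a set set \<Rightarrow> ('a set \<Rightarrow> nat) \<Rightarrow> ('a \<Rightarrow> enat) \<Rightarrow> ('a gword \<times> 'a gword) set" where
  "dyer_relations V E m f =
     {(replicate n (x, True), []) | x n. x \<in> V \<and> f x = enat n} \<union>
     {(alt_word x y (m {x, y}), alt_word y x (m {x, y})) | x y. {x, y} \<in> E}"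

definition dyer_group ::
    "'a set \<Rightarrow> 'a set set \<Rightarrow> ('a set \<Rightarrow> nat) \<Rightarrow> ('a \<Rightarrow> enat) \<Rightarrow> 'a gword set monoid" where
  "dyer_group V E m f = presented_group V (dyer_relations V E m f)"

text \<open>The image of \<open>V\<close> in the Dyer group.\<close>

definition dyer_gens ::
    "'a set \<Rightarrow> 'a set set \<Rightarrow> ('a set \<Rightarrow> nat) \<Rightarrow> ('a \<Rightarrow> enat) \<Rightarrow> 'a gword set set" where
  "dyer_gens V E m f = pres_gens V (dyer_relations V E m f)"

text \<open>Every Dyer relation takes part in \<open>pres_rel\<close>, which uses only pairs of words over the generators.\<close>

lemma (in dyer_graph) dyer_relations_gwords:
  "dyer_relations V E m f \<subseteq> gwords V \<times> gwords V"
proof -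
  have "alt_word x y n \<in> gwords V" if "x \<in> V" "y \<in> V" for x y n
    using that by (induction n arbitrary: x y) auto
  moreover have "replicate n (x, True) \<in> gwords V" if "x \<in> V" for x n
    using that by (induction n) auto
  moreover have "x \<in> V" "y \<in> V" if "{x, y} \<in> E" for x y
    using edge[OF that] by auto
  ultimately show ?thesis by (auto simp: dyer_relations_def)
qed

end

theory Submission
  imports Defs
begin

text \<open>
  To every letter of a word attach the wall it crosses, depending only on the element spelled by
  the preceding letters: for a generator \<open>x\<close> of order 2 the reflection \<open>p x p\<inverse>\<close>, for any other \<open>x\<close>
  the coset of \<open>p\<close> modulo the subgroup generated by the star of \<open>x\<close>. The signed number of crossings of
  a wall, modulo the order of its generator, respects the relations and is hence a function
  of the group element. Crossings of the same wall can be gathered in one place, so a word is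
  geodesic exactly when it crosses every wall as few times as this residue allows. This gives
  length-additive coset representatives for the parabolic subgroups \<open>D_I\<close>, recognised by having no
  descent in \<open>I\<close>. Inclusion-exclusion over descents yields
  \<open>\<Sum>I\<subseteq>J. (-1)^|I| D_J(t) / D_I(t) = F_J(t)\<close>, where \<open>F_J\<close> counts the elements having all of
  \<open>J\<close> as descents. Two descents, one of which is not an involution, commute; so either a generator
  splits off as a direct cyclic factor, or at most one such element exists (the longest element,
  if all of \<open>J\<close> are involutions). Rationality follows by induction on \<open>J\<close>.
\<close>

section \<open>Walls\<close>

definition sg :: "bool \<Rightarrow> int" where
  "sg b = (if b then 1 else -1)"

text \<open>
  The word length of \<open>k\<close> in the cyclic group of order \<open>n\<close>; the order \<open>0\<close> stands for the infinite
  cyclic group, in accordance with \<open>k mod 0 = k\<close>.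
\<close>

definition cyc :: "nat \<Rightarrow> int \<Rightarrow> nat" where
  "cyc n k = (if n = 0 then nat \<bar>k\<bar> else nat (min (k mod int n) (int n - k mod int n)))"

lemma cyc_cong: "k mod int n = l mod int n \<Longrightarrow> cyc n k = cyc n l"
  by (auto simp: cyc_def)

lemma cyc_eq_0_iff: "cyc n k = 0 \<longleftrightarrow> k mod int n = 0"
proof (cases "n = 0")
  case False
  then have "k mod int n \<ge> 0" "k mod int n < int n" by auto
  with False show ?thesis by (auto simp: cyc_def min_def)
qed (auto simp: cyc_def)

text \<open>\<open>cyc n k\<close> is the least absolute value in the residue class of
  \<open>k\<close>, and \<open>k\<close> itself belongs to that class.\<close>

lemma cyc_le_abs: "int (cyc n k) \<le> \<bar>k\<bar>"
proof (cases "n = 0")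
  case False
  then have *: "k mod int n \<ge> 0" "k mod int n < int n" by auto
  show ?thesis
  proof (cases "k \<ge> 0")
    case True
    then have "k mod int n \<le> k" using False by (simp add: zmod_le_nonneg_dividend)
    with True * False show ?thesis by (auto simp: cyc_def min_def)
  next
    case neg: False
    have "int n - k mod int n \<le> \<bar>k\<bar>" if "k mod int n \<noteq> 0"
    proof -
      have "(-k) mod int n = int n - k mod int n"
        using that by (simp add: zmod_zminus1_eq_if)
      moreover have "(-k) mod int n \<le> -k"
        using neg False by (simp add: zmod_le_nonneg_dividend)
      ultimately show ?thesis using neg by simp
    qed
    with * False neg show ?thesis by (cases "k mod int n = 0") (auto simp: cyc_def min_def)
  qed
qed (simp add: cyc_def)

lemma gwords_mono: "I \<subseteq> J \<Longrightarrow> ws \<in> gwords I \<Longrightarrow> ws \<in> gwords J"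
  by (auto simp: gwords_def)

lemma gwords_replicate: "x \<in> I \<Longrightarrow> replicate k (x, b) \<in> gwords I"
  by (induction k) auto

lemma alt_word_gwords: "x \<in> X \<Longrightarrow> y \<in> X \<Longrightarrow> alt_word x y k \<in> gwords X"
  by (induction k arbitrary: x y) auto

lemma alt_word_snoc: "alt_word x y (Suc k) = alt_word x y k @ [(if even k then x else y, True)]"
  by (induction k arbitrary: x y) auto

text \<open>Only what can be read off a presentation directly is assumed, so that crossings can be
  defined before their invariance is proved. \<open>n x\<close> is an exponent killing
  \<open>e x\<close>, with \<open>0\<close> for no condition; \<open>C x\<close> is the star of
  \<open>x\<close>.\<close>

locale walled_group = group G for G (structure) +
  fixes V :: "'v set" and e :: "'v \<Rightarrow> 'a" and n :: "'v \<Rightarrow> nat" and C :: "'v \<Rightarrow> 'v set"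
  assumes finite_V: "finite V"
    and e_closed: "x \<in> V \<Longrightarrow> e x \<in> carrier G"
    and e_pow: "x \<in> V \<Longrightarrow> e x [^] n x = \<one>"
    and star_sub: "x \<in> V \<Longrightarrow> C x \<subseteq> V"
    and star_self: "x \<in> V \<Longrightarrow> x \<in> C x"
    and star_commute: "x \<in> V \<Longrightarrow> y \<in> C x \<Longrightarrow> e y \<otimes> e x = e x \<otimes> e y"
begin

lemma mult_inv_cancel: "g \<in> carrier G \<Longrightarrow> h \<in> carrier G \<Longrightarrow> g \<otimes> (inv g \<otimes> h) = h"
  by (simp flip: m_assoc)

definition letter :: "'v \<times> bool \<Rightarrow> 'a" where
  "letter a = e (fst a) [^] sg (snd a)"

primrec eval :: "'v gword \<Rightarrow> 'a" where
  "eval [] = \<one>"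
| "eval (a # ws) = letter a \<otimes> eval ws"

definition par :: "'v set \<Rightarrow> 'a set" where
  "par I = eval ` gwords I"

text \<open>
  The element \<open>p x p\<inverse>\<close> alone would be too coarse for generators that are not involutions: that it
  determines the coset modulo \<open>par (C x)\<close> is not known beforehand, and that coset is what makes
  two descents commute. Generators of order 2 share the tag \<open>None\<close> because a braid relation of odd
  length conjugates one into the other.
\<close>

definition wall :: "'a \<Rightarrow> 'v \<Rightarrow> 'v option \<times> 'a set" where
  "wall p x = (if n x = 2 then (None, {p \<otimes> e x \<otimes> inv p}) else (Some x, (\<lambda>c. p \<otimes> c) ` par (C x)))"

definition wall_order :: "'v option \<times> 'a set \<Rightarrow> nat" where
  "wall_order w = (case fst w of None \<Rightarrow> 2 | Some x \<Rightarrow> n x)"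

text \<open>\<open>p\<close> is the element already reached when the word starts. Inverse letters
  can be treated like positive ones because the elements before and after a letter give the same
  wall (\<open>wall_pow\<close>).\<close>

primrec cnt :: "'a \<Rightarrow> 'v gword \<Rightarrow> 'v option \<times> 'a set \<Rightarrow> nat" where
  "cnt p [] w = 0"
| "cnt p (a # ws) w = (if wall p (fst a) = w then 1 else 0) + cnt (p \<otimes> letter a) ws w"

primrec cross :: "'a \<Rightarrow> 'v gword \<Rightarrow> 'v option \<times> 'a set \<Rightarrow> int" where
  "cross p [] w = 0"
| "cross p (a # ws) w = (if wall p (fst a) = w then sg (snd a) else 0) + cross (p \<otimes> letter a) ws w"

lemma letter_closed [simp]: "fst a \<in> V \<Longrightarrow> letter a \<in> carrier G"
  by (simp add: letter_def e_closed)

lemma eval_closed [simp]: "ws \<in> gwords V \<Longrightarrow> eval ws \<in> carrier G"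
  by (induction ws) auto

lemma eval_append: "us \<in> gwords V \<Longrightarrow> vs \<in> gwords V \<Longrightarrow> eval (us @ vs) = eval us \<otimes> eval vs"
  by (induction us) (auto simp: m_assoc)

lemma letter_inverse: "x \<in> V \<Longrightarrow> letter (x, b) \<otimes> letter (x, \<not> b) = \<one>"
  by (cases b) (simp_all add: letter_def sg_def int_pow_neg e_closed)

lemma inv_letter: "x \<in> V \<Longrightarrow> inv (letter (x, b)) = letter (x, \<not> b)"
  by (cases b) (simp_all add: letter_def sg_def int_pow_neg e_closed)

lemma eval_inverse:
  "ws \<in> gwords I \<Longrightarrow> I \<subseteq> V \<Longrightarrow> \<exists>vs\<in>gwords I. eval vs = inv (eval ws) \<and> length vs = length ws"
proof (induction ws)
  case (Cons a ws)
  then obtain vs where vs: "vs \<in> gwords I" "eval vs = inv (eval ws)" "length vs = length ws" by auto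
  obtain x b where a: "a = (x, b)" by force
  have V: "ws \<in> gwords V" "vs \<in> gwords V" "x \<in> V"
    using Cons.prems vs(1) a gwords_mono[OF Cons.prems(2)] by auto
  then show ?case using vs Cons.prems a
    by (intro bexI[of _ "vs @ [(x, \<not> b)]"]) (auto simp: eval_append inv_mult_group inv_letter)
qed (auto intro: bexI[of _ "[]"])

section \<open>Parabolic subgroups\<close>

lemma par_mono: "I \<subseteq> J \<Longrightarrow> par I \<subseteq> par J"
  unfolding par_def using gwords_mono[of I J] by auto

lemma par_closed: "I \<subseteq> V \<Longrightarrow> g \<in> par I \<Longrightarrow> g \<in> carrier G"
  unfolding par_def using gwords_mono[of I V] by auto

lemma one_in_par [simp]: "\<one> \<in> par I"
  unfolding par_def by (rule image_eqI[of _ _ "[]"]) auto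

lemma par_mult: "I \<subseteq> V \<Longrightarrow> g \<in> par I \<Longrightarrow> h \<in> par I \<Longrightarrow> g \<otimes> h \<in> par I"
  unfolding par_def
proof clarify
  fix us vs assume "I \<subseteq> V" "us \<in> gwords I" "vs \<in> gwords I"
  then show "eval us \<otimes> eval vs \<in> eval ` gwords I"
    by (intro image_eqI[of _ _ "us @ vs"]) (simp_all add: eval_append gwords_mono[of I V])
qed

lemma par_inv:
  assumes "I \<subseteq> V" "g \<in> par I"
  shows "inv g \<in> par I"
proof -
  obtain ws where ws: "ws \<in> gwords I" "g = eval ws" using assms(2) by (auto simp: par_def)
  from eval_inverse[OF ws(1) assms(1)] obtain vs where "vs \<in> gwords I" "eval vs = inv g"
    using ws(2) by auto
  then show ?thesis unfolding par_def by (metis imageI)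
qed

lemma letter_in_par: "I \<subseteq> V \<Longrightarrow> x \<in> I \<Longrightarrow> letter (x, b) \<in> par I"
  unfolding par_def by (rule image_eqI[of _ _ "[(x, b)]"]) (simp_all add: subset_iff)

lemma e_in_par:
  assumes "I \<subseteq> V" "x \<in> I"
  shows "e x \<in> par I"
proof -
  have "x \<in> V" using assms by blast
  then show ?thesis using letter_in_par[OF assms, of True] by (simp add: letter_def sg_def e_closed)
qed

lemma par_subgroup: "I \<subseteq> V \<Longrightarrow> subgroup (par I) G"
  by (rule subgroupI) (auto simp: par_closed[of I] par_inv[of I] par_mult[of I] intro: one_in_par[of I])

lemma par_int_pow: 
  assumes "I \<subseteq> V" "g \<in> par I" shows "g [^] (k::int) \<in> par I"
  using subgroup_int_pow_closed[OF par_subgroup[OF assms(1)] assms(2)] .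

lemma letter_commute:
  assumes "y \<in> V" "z \<in> carrier G" "e y \<otimes> z = z \<otimes> e y"
  shows "letter (y, b) \<otimes> z = z \<otimes> letter (y, b)"
proof (cases b)
  case True
  then show ?thesis using assms by (simp add: letter_def sg_def e_closed)
next
  case False
  have "inv (e y) \<otimes> z = z \<otimes> inv (e y)"
    using assms by (metis e_closed inv_closed inv_solve_left inv_solve_right m_assoc m_closed)
  then show ?thesis using False assms by (simp add: letter_def sg_def int_pow_neg e_closed)
qed

lemma par_commute:
  assumes "I \<subseteq> V" "z \<in> carrier G" "\<And>y. y \<in> I \<Longrightarrow> e y \<otimes> z = z \<otimes> e y" "g \<in> par I"
  shows "g \<otimes> z = z \<otimes> g"
proof -
  obtain ws where ws: "ws \<in> gwords I" "g = eval ws" using assms(4) by (auto simp: par_def)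
  have "eval ws \<otimes> z = z \<otimes> eval ws" using ws(1)
  proof (induction ws)
    case (Cons a ws)
    have a: "fst a \<in> I" "fst a \<in> V" "ws \<in> gwords V"
      using Cons.prems assms(1) gwords_mono[OF assms(1)] by auto
    have "letter a \<otimes> eval ws \<otimes> z = letter a \<otimes> (z \<otimes> eval ws)"
      using Cons a assms(2) by (simp add: m_assoc)
    also have "\<dots> = z \<otimes> (letter a \<otimes> eval ws)"
      using letter_commute[of "fst a" z "snd a"] a assms(2,3) by (simp flip: m_assoc)
    finally show ?case by simp
  qed (use assms in auto)
  then show ?thesis by (simp add: ws)
qed

lemma star_par_commute: "x \<in> V \<Longrightarrow> c \<in> par (C x) \<Longrightarrow> c \<otimes> e x = e x \<otimes> c"
  by (rule par_commute[OF star_sub e_closed]) (blast intro: star_commute)+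

lemma wall_order_wall [simp]: "wall_order (wall p x) = n x"
  by (auto simp: wall_order_def wall_def)

text \<open>Walls of the coset kind determine the conjugate too: two representatives differ by an
  element of \<open>par (C x)\<close>, which commutes with \<open>e x\<close>.\<close>

lemma wall_conj:
  assumes "wall p x = wall q y" "p \<in> carrier G" "q \<in> carrier G" "x \<in> V" "y \<in> V"
  shows "p \<otimes> e x \<otimes> inv p = q \<otimes> e y \<otimes> inv q"
proof (cases "n x = 2")
  case True
  then show ?thesis using assms by (auto simp: wall_def split: if_splits)
next
  case False
  then have y: "y = x" "(\<lambda>c. p \<otimes> c) ` par (C x) = (\<lambda>c. q \<otimes> c) ` par (C x)"
    using assms by (auto simp: wall_def split: if_splits)
  then have "q \<in> (\<lambda>c. p \<otimes> c) ` par (C x)"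
    using assms(3) one_in_par by (metis imageI r_one)
  then obtain c where c: "c \<in> par (C x)" "q = p \<otimes> c" by blast
  have cc: "c \<in> carrier G" "e x \<in> carrier G" 
    using par_closed[OF star_sub[OF assms(4)] c(1)] e_closed[OF assms(4)] by auto
  have "q \<otimes> e x \<otimes> inv q = p \<otimes> (c \<otimes> e x) \<otimes> (inv c \<otimes> inv p)"
    using c cc assms by (simp add: inv_mult_group m_assoc)
  also have "\<dots> = p \<otimes> e x \<otimes> inv p"
    using cc assms star_par_commute[OF assms(4) c(1)] by (simp add: m_assoc mult_inv_cancel)
  finally show ?thesis using y by simp
qed

text \<open>Left multiplication by \<open>g\<close> conjugates the singleton of one kind of wall and
  translates the coset of the other.\<close>

lemma wall_left_imp:
  assumes "wall p x = wall q y" "p \<in> carrier G" "q \<in> carrier G" "g \<in> carrier G" "x \<in> V" "y \<in> V"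
  shows "wall (g \<otimes> p) x = wall (g \<otimes> q) y"
proof (cases "n x = 2")
  case True
  then have "n y = 2" using assms(1) by (auto simp: wall_def split: if_splits)
  have *: "g \<otimes> p \<otimes> e x \<otimes> inv (g \<otimes> p) = g \<otimes> (p \<otimes> e x \<otimes> inv p) \<otimes> inv g" if "p \<in> carrier G" "x \<in> V" for p x
    using that assms(4) by (simp add: inv_mult_group m_assoc e_closed)
  show ?thesis using True \<open>n y = 2\<close> *[of p x] *[of q y] assms wall_conj[OF assms(1)] by (simp add: wall_def)
next
  case False
  then have y: "y = x" "(\<lambda>c. p \<otimes> c) ` par (C x) = (\<lambda>c. q \<otimes> c) ` par (C x)"
    using assms by (auto simp: wall_def split: if_splits)
  have *: "(\<lambda>c. g \<otimes> p \<otimes> c) ` par (C x) = (\<lambda>c. g \<otimes> c) ` (\<lambda>c. p \<otimes> c) ` par (C x)" if "p \<in> carrier G" for p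
    unfolding image_image using that assms par_closed[OF star_sub, of x] by (intro image_cong) (auto simp: m_assoc)
  show ?thesis using False y *[of p] *[of q] assms by (simp add: wall_def)
qed

lemma wall_left:
  assumes "p \<in> carrier G" "q \<in> carrier G" "g \<in> carrier G" "x \<in> V" "y \<in> V"
  shows "wall (g \<otimes> p) x = wall (g \<otimes> q) y \<longleftrightarrow> wall p x = wall q y"
proof
  assume "wall (g \<otimes> p) x = wall (g \<otimes> q) y"
  from wall_left_imp[OF this _ _ _ assms(4,5), of "inv g"] show "wall p x = wall q y"
    using assms by (simp flip: m_assoc)
qed (rule wall_left_imp[OF _ assms(1,2,3,4,5)])

text \<open>For \<open>n x = 2\<close> the wall is a conjugate, preserved by whatever commutes with
  \<open>e x\<close>; otherwise it is a coset, which absorbs \<open>c\<close> only if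
  \<open>c\<close> lies in \<open>par (C x)\<close>.\<close>

lemma wall_star:
  assumes "p \<in> carrier G" "x \<in> V" "c \<in> carrier G" "c \<otimes> e x = e x \<otimes> c" "n x = 2 \<or> c \<in> par (C x)"
  shows "wall (p \<otimes> c) x = wall p x"
proof (cases "n x = 2")
  case True
  have "p \<otimes> c \<otimes> e x \<otimes> inv (p \<otimes> c) = p \<otimes> (c \<otimes> e x) \<otimes> (inv c \<otimes> inv p)"
    using assms by (simp add: inv_mult_group m_assoc e_closed)
  also have "\<dots> = p \<otimes> e x \<otimes> inv p"
    using assms by (simp add: m_assoc mult_inv_cancel e_closed)
  finally show ?thesis using True by (simp add: wall_def)
next
  case False
  then have c: "c \<in> par (C x)" using assms by blast
  note sub = star_sub[OF assms(2)]
  have "(\<lambda>d. p \<otimes> c \<otimes> d) ` par (C x) = (\<lambda>d. p \<otimes> d) ` (\<lambda>d. c \<otimes> d) ` par (C x)"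
    unfolding image_image using assms par_closed[OF sub] by (intro image_cong) (auto simp: m_assoc)
  also have "(\<lambda>d. c \<otimes> d) ` par (C x) = par (C x)"
  proof
    show "par (C x) \<subseteq> (\<lambda>d. c \<otimes> d) ` par (C x)"
    proof
      fix d assume d: "d \<in> par (C x)"
      then show "d \<in> (\<lambda>d. c \<otimes> d) ` par (C x)"
        using c assms(3) par_closed[OF sub] par_inv[OF sub] par_mult[OF sub]
        by (intro image_eqI[of _ _ "inv c \<otimes> d"]) (auto simp flip: m_assoc)
    qed
  qed (use c par_mult[OF sub] in auto)
  finally show ?thesis using False by (simp add: wall_def)
qed

text \<open>\<open>e x\<close> commutes with its powers and \<open>x\<close> lies in its own star,
  so a run of letters \<open>x\<close> stays on one single wall.\<close>

lemma wall_pow: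
  assumes "p \<in> carrier G" "x \<in> V" shows "wall (p \<otimes> e x [^] (k::int)) x = wall p x"
proof (rule wall_star)
  show "e x [^] k \<otimes> e x = e x \<otimes> e x [^] k"
    using int_pow_mult[OF e_closed[OF assms(2)], of k 1] int_pow_mult[OF e_closed[OF assms(2)], of 1 k] assms
    by (simp add: e_closed add.commute)
  show "n x = 2 \<or> e x [^] k \<in> par (C x)"
    using par_int_pow[OF star_sub e_in_par[OF star_sub star_self], OF assms(2,2,2)] by simp
qed (use assms e_closed in auto)

section \<open>Crossings of words\<close>

lemma cnt_append:
  "us \<in> gwords V \<Longrightarrow> vs \<in> gwords V \<Longrightarrow> p \<in> carrier G \<Longrightarrow> 
    cnt p (us @ vs) w = cnt p us w + cnt (p \<otimes> eval us) vs w"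
  by (induction us arbitrary: p) (auto simp: m_assoc)

lemma cross_append:
  "us \<in> gwords V \<Longrightarrow> vs \<in> gwords V \<Longrightarrow> p \<in> carrier G \<Longrightarrow> 
    cross p (us @ vs) w = cross p us w + cross (p \<otimes> eval us) vs w"
  by (induction us arbitrary: p) (auto simp: m_assoc)

lemma cnt_left:
  assumes "ws \<in> gwords V" "p \<in> carrier G" "q \<in> carrier G" "g \<in> carrier G" "y \<in> V"
  shows "cnt (g \<otimes> p) ws (wall (g \<otimes> q) y) = cnt p ws (wall q y)"
  using assms by (induction ws arbitrary: p) (auto simp: wall_left m_assoc)

lemma cross_left:
  assumes "ws \<in> gwords V" "p \<in> carrier G" "q \<in> carrier G" "g \<in> carrier G" "y \<in> V"
  shows "cross (g \<otimes> p) ws (wall (g \<otimes> q) y) = cross p ws (wall q y)"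
  using assms by (induction ws arbitrary: p) (auto simp: wall_left m_assoc)

lemma abs_cross_le_cnt: "\<bar>cross p ws w\<bar> \<le> int (cnt p ws w)"
proof (induction ws arbitrary: p)
  case (Cons a ws)
  from Cons[of "p \<otimes> letter a"] show ?case by (auto simp: sg_def)
qed simp

lemma cnt_split:
  assumes "cnt p ws w \<noteq> 0"
  shows "\<exists>us a vs. ws = us @ a # vs \<and> (ws \<in> gwords V \<longrightarrow> p \<in> carrier G \<longrightarrow> wall (p \<otimes> eval us) (fst a) = w \<and> cnt p us w = 0)"
  using assms
proof (induction ws arbitrary: p)
  case (Cons a ws)
  show ?case
  proof (cases "wall p (fst a) = w")
    case True
    then show ?thesis by (intro exI[of _ "[]"] exI[of _ a] exI[of _ ws]) auto
  next
    case False
    then have "cnt (p \<otimes> letter a) ws w \<noteq> 0" using Cons.prems by simp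
    from Cons.IH[OF this] obtain us b vs where us: "ws = us @ b # vs"
      "ws \<in> gwords V \<longrightarrow> p \<otimes> letter a \<in> carrier G \<longrightarrow>
        wall (p \<otimes> letter a \<otimes> eval us) (fst b) = w \<and> cnt (p \<otimes> letter a) us w = 0" by blast
    then show ?thesis using False
      by (intro exI[of _ "a # us"] exI[of _ b] exI[of _ vs]) (auto simp: m_assoc)
  qed
qed simp

text \<open>
  All crossings of one wall can be moved to the front: each of them multiplies from the left by
  a power of the conjugate \<open>r\<close> attached to the wall.
\<close>

lemma extract_wall:
  assumes "ws \<in> gwords I" "I \<subseteq> V" "p \<in> carrier G" "q \<in> carrier G" "x \<in> V"
  defines "r \<equiv> q \<otimes> e x \<otimes> inv q"
  shows "\<exists>vs\<in>gwords I. p \<otimes> eval ws = r [^] cross p ws (wall q x) \<otimes> (p \<otimes> eval vs) \<and>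
    length vs + cnt p ws (wall q x) = length ws"
  using assms(1,3)
proof (induction ws arbitrary: p)
  case Nil
  then show ?case by (intro bexI[of _ "[]"]) auto
next
  case (Cons a ws)
  have r: "r \<in> carrier G" using assms e_closed by simp
  have a: "fst a \<in> I" "fst a \<in> V" "ws \<in> gwords I" "ws \<in> gwords V" "p \<in> carrier G" 
    using Cons.prems assms(2) gwords_mono[OF assms(2)] by auto
  let ?p = "p \<otimes> letter a"
  obtain vs where vs: "vs \<in> gwords I" 
    "?p \<otimes> eval ws = r [^] cross ?p ws (wall q x) \<otimes> (?p \<otimes> eval vs)"
    "length vs + cnt ?p ws (wall q x) = length ws"
    using Cons.IH[of ?p] a by auto
  have vsV: "vs \<in> gwords V" using gwords_mono[OF assms(2) vs(1)] .
  have pw: "p \<otimes> eval (a # ws) = ?p \<otimes> eval ws" using a by (simp add: m_assoc)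
  show ?case
  proof (cases "wall p (fst a) = wall q x")
    case True
    have "p \<otimes> e (fst a) \<otimes> inv p = r"
      using wall_conj[OF True] a assms by simp
    then have rp: "r \<otimes> p = p \<otimes> e (fst a)"
      using a r by (metis e_closed inv_closed inv_solve_right m_closed)
    have "?p = r [^] sg (snd a) \<otimes> p"
    proof (cases "snd a")
      case True
      then show ?thesis using rp r a by (simp add: letter_def sg_def e_closed)
    next
      case False
      have "p = r \<otimes> (p \<otimes> inv (e (fst a)))"
        using rp a r by (metis e_closed inv_closed inv_solve_right m_assoc m_closed)
      then have "inv r \<otimes> p = p \<otimes> inv (e (fst a))"
        using a r e_closed by (metis inv_closed inv_solve_left m_closed)
      then show ?thesis using False a r by (simp add: letter_def sg_def e_closed int_pow_neg)
    qed
    then have "p \<otimes> eval (a # ws) = r [^] cross ?p ws (wall q x) \<otimes> (r [^] sg (snd a) \<otimes> p \<otimes> eval vs)"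
      using vs pw by simp
    also have "\<dots> = r [^] (cross ?p ws (wall q x) + sg (snd a)) \<otimes> (p \<otimes> eval vs)"
      using r a vsV by (simp add: int_pow_mult m_assoc)
    finally show ?thesis using vs True by (intro bexI[of _ vs]) (auto simp: add.commute)
  next
    case False
    then show ?thesis using vs pw a vsV by (intro bexI[of _ "a # vs"]) (auto simp: m_assoc)
  qed
qed

section \<open>Powers of one generator\<close>

lemma eval_replicate: "x \<in> V \<Longrightarrow> eval (replicate k (x, b)) = e x [^] (sg b * int k)"
proof (induction k)
  case (Suc k)
  have "eval (replicate (Suc k) (x, b)) = e x [^] (sg b + sg b * int k)"
    using Suc by (simp add: letter_def int_pow_mult e_closed)
  then show ?case by (simp add: algebra_simps)
qed simp

lemma e_pow_cong:
  assumes "x \<in> V" "k mod int (n x) = l mod int (n x)"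
  shows "e x [^] (k::int) = e x [^] l"
proof -
  obtain j where "k = l + int (n x) * j" using assms(2) by (metis mod_eqE)
  moreover have "e x [^] (int (n x) * j) = \<one>"
    using e_pow[OF assms(1)] int_pow_pow[OF e_closed[OF assms(1)], of "int (n x)" j]
    by (simp add: int_pow_int)
  ultimately show ?thesis using assms by (simp add: int_pow_mult e_closed)
qed

text \<open>Replaces the gathered crossings of a wall, with total exponent \<open>k\<close>, by a
  run of only \<open>cyc (n x) k\<close> letters; geodesics are compared with the result.\<close>

lemma syllable:
  assumes "x \<in> V"
  shows "\<exists>b. e x [^] k = eval (replicate (cyc (n x) k) (x, b))"
proof (cases "n x = 0")
  case True
  show ?thesis using True assms
    by (intro exI[of _ "k \<ge> 0"]) (auto simp: eval_replicate sg_def cyc_def)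
next
  case False
  then have m: "0 \<le> k mod int (n x)" "k mod int (n x) < int (n x)" by auto
  \<comment> \<open>The representative of \<open>k\<close> closest to zero, the positive one in a
    tie. Its sign decides \<open>b\<close>.\<close>
  define l where "l = (if k mod int (n x) \<le> int (n x) - k mod int (n x) then k mod int (n x) else k mod int (n x) - int (n x))"
  have "l mod int (n x) = k mod int (n x)" by (simp add: l_def)
  moreover have "l = sg (l \<ge> 0) * int (cyc (n x) k)"
    using m less_imp_le[OF m(2)] False by (auto simp: l_def sg_def cyc_def min_def)
  ultimately show ?thesis using e_pow_cong[OF assms] assms
    by (intro exI[of _ "l \<ge> 0"]) (metis eval_replicate)
qed

lemma cross_replicate:
  assumes "x \<in> V" "p \<in> carrier G"
  shows "cross p (replicate k (x, b)) w = (if wall p x = w then sg b * int k else 0) \<and>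
    cnt p (replicate k (x, b)) w = (if wall p x = w then k else 0)"
  using assms(2)
proof (induction k arbitrary: p)
  case (Suc k)
  have "wall (p \<otimes> letter (x, b)) x = wall p x"
    using wall_pow[OF Suc.prems assms(1)] by (simp add: letter_def)
  then show ?case using Suc.IH[of "p \<otimes> letter (x, b)"] Suc.prems assms(1) by (simp add: algebra_simps)
qed simp

section \<open>Alternating words and braid relations\<close>

lemma letter_True: "x \<in> V \<Longrightarrow> letter (x, True) = e x"
  by (simp add: letter_def sg_def e_closed)

lemma eval_alt_snoc:
  assumes "x \<in> V" "y \<in> V"
  shows "eval (alt_word x y (Suc k)) = eval (alt_word x y k) \<otimes> e (if even k then x else y)"
  unfolding alt_word_snoc using assms
  by (subst eval_append) (auto simp: alt_word_gwords letter_True e_closed)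

lemma involution: "x \<in> V \<Longrightarrow> n x = 2 \<Longrightarrow> e x \<otimes> e x = \<one>"
  using e_pow[of x] e_closed[of x] by (simp add: numeral_2_eq_2)

text \<open>Multiplying both sides of the braid relation on the right by the same involution
  lengthens one side and cancels the last letter of the other.\<close>

lemma alt_flip_aux:
  assumes "x \<in> V" "y \<in> V" "n x = 2" "n y = 2" "eval (alt_word x y m) = eval (alt_word y x m)" "d \<le> m"
  shows "eval (alt_word x y (m + d)) = eval (alt_word y x (m - d))"
  using assms(6)
proof (induction d)
  case (Suc d)
  \<comment> \<open>The letter following the first \<open>m + d\<close> on the left is also the last
    one on the right, as \<open>m + d\<close> and \<open>m - Suc d\<close> have opposite
    parity.\<close>
  define z where "z = (if even (m + d) then x else y)"
  have z: "z \<in> V" "n z = 2" using assms by (auto simp: z_def)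
  have Suc': "m - d = Suc (m - Suc d)" using Suc.prems by simp
  have "even (m - Suc d) \<longleftrightarrow> odd (m + d)" using Suc.prems by presburger
  then have "eval (alt_word y x (m - d)) = eval (alt_word y x (m - Suc d)) \<otimes> e z"
    unfolding Suc' eval_alt_snoc[OF assms(2,1)] z_def by simp
  moreover have "eval (alt_word x y (m + Suc d)) = eval (alt_word x y (m + d)) \<otimes> e z"
    using eval_alt_snoc[OF assms(1,2), of "m + d"] by (simp add: z_def)
  ultimately have "eval (alt_word x y (m + Suc d)) = eval (alt_word y x (m - Suc d)) \<otimes> (e z \<otimes> e z)"
    using Suc z assms by (simp add: m_assoc alt_word_gwords e_closed)
  then show ?case using involution[OF z] assms by (simp add: alt_word_gwords)
qed (use assms in simp)

text \<open>Reflects the length about \<open>m\<close>; for \<open>a < m\<close> the roles of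
  \<open>x\<close> and \<open>y\<close> are exchanged.\<close>

lemma alt_flip:
  assumes "x \<in> V" "y \<in> V" "n x = 2" "n y = 2" "eval (alt_word x y m) = eval (alt_word y x m)" "a \<le> 2 * m"
  shows "eval (alt_word x y a) = eval (alt_word y x (2 * m - a))"
proof (cases "m \<le> a")
  case True
  then show ?thesis using alt_flip_aux[OF assms(1-5), of "a - m"] assms(6)
    by (simp add: mult_2)
next
  case False
  then show ?thesis using alt_flip_aux[OF assms(2,1,4,3) assms(5)[symmetric], of "m - a"]
    by (simp add: mult_2)
qed

text \<open>Conjugating the letter at position \<open>i\<close> by the \<open>i\<close> involutions
  before it gives an alternating palindrome of length \<open>2 * i + 1\<close>. Every sign is
  positive.\<close>

lemma cross_alt:
  assumes "x \<in> V" "y \<in> V" "n x = 2" "n y = 2" "p \<in> carrier G"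
  shows "cross p (alt_word x y m) w =
    (\<Sum>i<m. if (None, {p \<otimes> eval (alt_word x y (Suc (2 * i))) \<otimes> inv p}) = w then 1 else 0)"
  using assms
proof (induction m arbitrary: x y p)
  case (Suc m)
  note x = e_closed[OF Suc.prems(1)] and al = alt_word_gwords[OF Suc.prems(1,2)] alt_word_gwords[OF Suc.prems(2,1)]
  have ix: "inv (e x) = e x" using involution[OF Suc.prems(1,3)] x by (metis inv_equality)
  \<comment> \<open>Conjugation by \<open>e x\<close> adds the letter \<open>x\<close> at both ends
    of the palindrome.\<close>
  have W: "p \<otimes> e x \<otimes> eval (alt_word y x (Suc (2 * i))) \<otimes> inv (p \<otimes> e x) =
      p \<otimes> eval (alt_word x y (Suc (2 * Suc i))) \<otimes> inv p" for i
  proof -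
    have "eval (alt_word x y (Suc (2 * Suc i))) = e x \<otimes> eval (alt_word y x (Suc (Suc (2 * i))))"
      using Suc.prems by (simp add: letter_True)
    also have "\<dots> = e x \<otimes> (eval (alt_word y x (Suc (2 * i))) \<otimes> e x)"
      by (subst eval_alt_snoc[OF Suc.prems(2,1)]) simp
    finally show ?thesis
      using Suc.prems(5) x al by (simp add: inv_mult_group ix m_assoc del: alt_word.simps)
  qed
  have "cross p (alt_word x y (Suc m)) w = (if wall p x = w then 1 else 0) + cross (p \<otimes> e x) (alt_word y x m) w"
    using Suc.prems by (simp add: letter_True sg_def)
  also have "cross (p \<otimes> e x) (alt_word y x m) w =
      (\<Sum>i<m. if (None, {p \<otimes> eval (alt_word x y (Suc (2 * Suc i))) \<otimes> inv p}) = w then 1 else 0)"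
    using Suc.IH[OF Suc.prems(2,1,4,3), of "p \<otimes> e x"] Suc.prems(5) x by (simp only: W m_closed)
  also have "wall p x = (None, {p \<otimes> eval (alt_word x y (Suc (2 * 0))) \<otimes> inv p})"
    using Suc.prems x by (simp add: wall_def letter_True)
  finally show ?case unfolding sum.lessThan_Suc_shift .
qed simp

text \<open>
  The \<open>i\<close>-th reflection crossed by one side of a braid relation is the \<open>(m - 1 - i)\<close>-th one crossed by
  the other side.
\<close>

lemma cross_braid:
  assumes "x \<in> V" "y \<in> V" "n x = 2" "n y = 2" "eval (alt_word x y m) = eval (alt_word y x m)" "p \<in> carrier G"
  shows "cross p (alt_word x y m) w = cross p (alt_word y x m) w"
proof -
  have "2 * m - Suc (2 * i) = Suc (2 * (m - Suc i))" if "i < m" for i using that by linarith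
  then have "eval (alt_word x y (Suc (2 * i))) = eval (alt_word y x (Suc (2 * (m - Suc i))))" if "i < m" for i
    using alt_flip[OF assms(1-5), of "Suc (2 * i)"] that by (simp del: alt_word.simps)
  then have "cross p (alt_word x y m) w =
      (\<Sum>i<m. if (None, {p \<otimes> eval (alt_word y x (Suc (2 * (m - Suc i)))) \<otimes> inv p}) = w then 1 else 0)"
    unfolding cross_alt[OF assms(1-4,6)] by (intro sum.cong HOL.refl) (simp del: alt_word.simps)
  also have "\<dots> = cross p (alt_word y x m) w"
    unfolding cross_alt[OF assms(2,1,4,3,6)]
    by (rule sum.nat_diff_reindex[of "\<lambda>i. if (None, {p \<otimes> eval (alt_word y x (Suc (2 * i))) \<otimes> inv p}) = w then 1 else 0"])
  finally show ?thesis .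
qed

text \<open>Each generator lies in the star of the other, so passing one of them does not move the
  wall of the other.\<close>

lemma cross_commute:
  assumes "x \<in> V" "y \<in> V" "y \<in> C x" "x \<in> C y" "p \<in> carrier G"
  shows "cross p [(x, True), (y, True)] w = cross p [(y, True), (x, True)] w"
proof -
  have "wall (p \<otimes> e x) y = wall p y" "wall (p \<otimes> e y) x = wall p x"
    using wall_star[OF assms(5,2) e_closed[OF assms(1)]] wall_star[OF assms(5,1) e_closed[OF assms(2)]]
      star_commute[OF assms(1,3)] e_in_par[OF star_sub] assms by auto
  then show ?thesis using assms by (simp add: letter_True)
qed

end

section \<open>Geodesics and parabolic cosets\<close>

text \<open>\<open>cross_cong\<close> makes crossing residues functions of the group element, from
  any starting point \<open>p\<close>.\<close>

locale wall_system = walled_group +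
  assumes carrier_par: "carrier G = par V"
    and cross_cong: "us \<in> gwords V \<Longrightarrow> vs \<in> gwords V \<Longrightarrow> eval us = eval vs \<Longrightarrow> p \<in> carrier G \<Longrightarrow>
      cross p us w mod int (wall_order w) = cross p vs w mod int (wall_order w)"
begin

text \<open>Minimality is required among words over \<open>I\<close> only; \<open>geo_len\<close>
  then yields it among words over \<open>V\<close>.\<close>

definition geo :: "'c set \<Rightarrow> 'c gword \<Rightarrow> bool" where
  "geo I ws \<longleftrightarrow> ws \<in> gwords I \<and> (\<forall>vs\<in>gwords I. eval vs = eval ws \<longrightarrow> length ws \<le> length vs)"

text \<open>The criterion for geodesics in terms of single walls; \<open>geo_tight\<close> and
  \<open>tight_length\<close> are its two directions.\<close>

definition tight :: "'c gword \<Rightarrow> bool" where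
  "tight ws \<longleftrightarrow> (\<forall>p\<in>carrier G. \<forall>w. cnt p ws w = cyc (wall_order w) (cross p ws w))"

definition len :: "'a \<Rightarrow> nat" where
  "len g = (LEAST k. \<exists>ws\<in>gwords V. eval ws = g \<and> length ws = k)"

text \<open>Left descents. A residue is used instead of a length comparison so that membership can
  be tested on any word for \<open>g\<close> (\<open>desc_eval\<close>).\<close>

definition desc :: "'a \<Rightarrow> 'c set" where
  "desc g = {x \<in> V. \<exists>ws\<in>gwords V. eval ws = g \<and> cross \<one> ws (wall \<one> x) mod int (n x) \<noteq> 0}"

lemma desc_eval:
  assumes "ws \<in> gwords V"
  shows "x \<in> desc (eval ws) \<longleftrightarrow> x \<in> V \<and> cross \<one> ws (wall \<one> x) mod int (n x) \<noteq> 0"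
proof
  assume "x \<in> desc (eval ws)"
  then obtain vs where vs: "x \<in> V" "vs \<in> gwords V" "eval vs = eval ws"
    "cross \<one> vs (wall \<one> x) mod int (n x) \<noteq> 0"
    by (auto simp: desc_def)
  then show "x \<in> V \<and> cross \<one> ws (wall \<one> x) mod int (n x) \<noteq> 0"
    using cross_cong[OF vs(2) assms vs(3) one_closed, of "wall \<one> x"] by simp
qed (use assms in \<open>auto simp: desc_def\<close>)

lemma cross_eq_0: "cnt p ws w = 0 \<Longrightarrow> cross p ws w = 0"
  using abs_cross_le_cnt[of p ws w] by simp

lemma tightD: "tight ws \<Longrightarrow> p \<in> carrier G \<Longrightarrow> cnt p ws w = cyc (wall_order w) (cross p ws w)"
  unfolding tight_def by blast

lemma geo_le: "geo I ws \<Longrightarrow> vs \<in> gwords I \<Longrightarrow> eval vs = eval ws \<Longrightarrow> length ws \<le> length vs"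
  unfolding geo_def by blast

lemma geo_transfer:
  "geo I ws \<Longrightarrow> vs \<in> gwords I \<Longrightarrow> eval vs = eval ws \<Longrightarrow> length vs = length ws \<Longrightarrow> geo I vs"
  unfolding geo_def by metis

lemma desc_tight:
  assumes "ws \<in> gwords V" "tight ws"
  shows "x \<in> desc (eval ws) \<longleftrightarrow> x \<in> V \<and> cnt \<one> ws (wall \<one> x) \<noteq> 0"
  using assms by (simp add: desc_eval tightD cyc_eq_0_iff)

text \<open>Translating by \<open>inv q\<close> turns \<open>wall q x\<close> into
  \<open>wall \<one> x\<close>, whose attached conjugate is \<open>e x\<close> itself.\<close>

lemma extract_first:
  assumes "ws \<in> gwords I" "I \<subseteq> V" "q \<in> carrier G" "x \<in> V"
  shows "\<exists>vs\<in>gwords I. eval ws = e x [^] cross q ws (wall q x) \<otimes> eval vs \<and>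
    length vs + cnt q ws (wall q x) = length ws"
proof -
  have wsV: "ws \<in> gwords V" using gwords_mono[OF assms(2,1)] .
  have c: "cnt q ws (wall q x) = cnt \<one> ws (wall \<one> x)" "cross q ws (wall q x) = cross \<one> ws (wall \<one> x)"
    using cnt_left[OF wsV one_closed one_closed assms(3,4)] cross_left[OF wsV one_closed one_closed assms(3,4)]
      assms by simp_all
  obtain vs where vs: "vs \<in> gwords I"
    "\<one> \<otimes> eval ws = (\<one> \<otimes> e x \<otimes> inv \<one>) [^] cross \<one> ws (wall \<one> x) \<otimes> (\<one> \<otimes> eval vs)"
    "length vs + cnt \<one> ws (wall \<one> x) = length ws"
    using extract_wall[OF assms(1,2) one_closed one_closed assms(4)] by blast
  have "vs \<in> gwords V" using gwords_mono[OF assms(2) vs(1)] .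
  then show ?thesis using vs wsV assms c e_closed by (intro bexI[of _ vs]) auto
qed

text \<open>If some wall were crossed too often, gathering its crossings at the first one and
  replacing them by a \<open>syllable\<close> would give a shorter word over
  \<open>I\<close>.\<close>

lemma geo_tight:
  assumes "geo I ws" "I \<subseteq> V"
  shows "tight ws"
  unfolding tight_def
proof (intro ballI allI)
  fix p w assume p: "p \<in> carrier G"
  have wsI: "ws \<in> gwords I" and wsV: "ws \<in> gwords V"
    using assms gwords_mono[OF assms(2)] by (auto simp: geo_def)
  show "cnt p ws w = cyc (wall_order w) (cross p ws w)"
  proof (cases "cnt p ws w = 0")
    case True
    then show ?thesis using cross_eq_0[OF True] by (simp add: cyc_def)
  next
    case False
    \<comment> \<open>\<open>a\<close> is the first crossing of \<open>w\<close>, so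
      \<open>us\<close> contributes nothing and all crossings can be gathered in front of
      \<open>a # ts\<close>.\<close>
    obtain us a ts where s: "ws = us @ a # ts" "wall (p \<otimes> eval us) (fst a) = w" "cnt p us w = 0"
      using cnt_split[OF False] wsV p by blast
    define q x where "q = p \<otimes> eval us" and "x = fst a"
    have mem: "us \<in> gwords I" "a # ts \<in> gwords I" "x \<in> I" "us \<in> gwords V" "a # ts \<in> gwords V" "x \<in> V" "q \<in> carrier G"
      using wsI wsV s p by (auto simp: q_def x_def)
    have w: "wall q x = w" "wall_order w = n x" using s(2) by (auto simp: q_def x_def)
    have tot: "cnt p ws w = cnt q (a # ts) w" "cross p ws w = cross q (a # ts) w"
      using s mem p cross_eq_0[OF s(3)] by (auto simp: cnt_append cross_append q_def simp del: cnt.simps cross.simps)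
    obtain vs where vs: "vs \<in> gwords I" "eval (a # ts) = e x [^] cross q (a # ts) w \<otimes> eval vs"
      "length vs + cnt q (a # ts) w = length (a # ts)"
      using extract_first[OF mem(2) assms(2) mem(7,6)] w by auto
    have vsV: "vs \<in> gwords V" using gwords_mono[OF assms(2) vs(1)] .
    define k where "k = cross p ws w"
    obtain b where b: "e x [^] k = eval (replicate (cyc (n x) k) (x, b))" using syllable[OF mem(6)] by blast
    let ?r = "replicate (cyc (n x) k) (x, b)"
    have r: "?r \<in> gwords I" "?r \<in> gwords V" using mem gwords_replicate by metis+
    have "eval (us @ ?r @ vs) = eval ws"
      using mem vs vsV r b tot s by (simp add: eval_append k_def del: eval.simps)
    then have "length ws \<le> length (us @ ?r @ vs)"
      using mem(1) vs(1) r(1) by (intro geo_le[OF assms(1)]) simp_all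
    then have "cnt p ws w \<le> cyc (n x) k" using vs(3) tot s(1) by simp
    moreover have "int (cyc (n x) k) \<le> int (cnt p ws w)"
      using cyc_le_abs[of "n x" k] abs_cross_le_cnt[of p ws w] by (simp add: k_def)
    ultimately show ?thesis using w by (simp add: k_def)
  qed
qed

section \<open>Tight words and word length\<close>

lemma sum_cnt_le: "finite W \<Longrightarrow> (\<Sum>w\<in>W. cnt p ws w) \<le> length ws"
proof (induction ws arbitrary: p)
  case (Cons a ws)
  from Cons.IH[of "p \<otimes> letter a"] Cons.prems show ?case by (auto simp: sum.distrib sum.delta)
qed simp

text \<open>Each letter crosses exactly one wall, so the walls met by the word account for all of
  its letters.\<close>

lemma sum_cnt_length: "\<exists>W. finite W \<and> (\<Sum>w\<in>W. cnt p ws w) = length ws"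
proof (induction ws arbitrary: p)
  case (Cons a ws)
  obtain W where W: "finite W" "(\<Sum>w\<in>W. cnt (p \<otimes> letter a) ws w) = length ws"
    using Cons[of "p \<otimes> letter a"] by blast
  let ?W = "insert (wall p (fst a)) W"
  \<comment> \<open>Enlarging \<open>W\<close> cannot lower the sum, which \<open>sum_cnt_le\<close>
    bounds from above; a newly added wall therefore contributes zero.\<close>
  have "length ws \<le> (\<Sum>w\<in>?W. cnt (p \<otimes> letter a) ws w)"
    using W sum_mono2[of ?W W "cnt (p \<otimes> letter a) ws"] by auto
  then have "(\<Sum>w\<in>?W. cnt (p \<otimes> letter a) ws w) = length ws"
    using sum_cnt_le[of ?W "p \<otimes> letter a" ws] W by simp
  then have "(\<Sum>w\<in>?W. cnt p (a # ws) w) = length (a # ws)"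
    using W by (simp add: sum.distrib sum.delta del: sum.insert sum.insert_if sum.insert_remove)
  then show ?case using W by blast
qed (auto intro: exI[of _ "{}"])

text \<open>Each wall contributes at least its residue to the length of any word for the same element.\<close>

lemma tight_length:
  assumes "tight ws" "ws \<in> gwords V" "vs \<in> gwords V" "eval vs = eval ws"
  shows "length ws \<le> length vs"
proof -
  obtain W where W: "finite W" "(\<Sum>w\<in>W. cnt \<one> ws w) = length ws" using sum_cnt_length by blast
  have "cnt \<one> ws w \<le> cnt \<one> vs w" for w
  proof -
    have "cnt \<one> ws w = cyc (wall_order w) (cross \<one> vs w)"
      using tightD[OF assms(1) one_closed] cyc_cong[OF cross_cong[OF assms(3,2,4) one_closed]] by simp
    then show ?thesis
      using cyc_le_abs[of "wall_order w" "cross \<one> vs w"] abs_cross_le_cnt[of \<one> vs w] by linarith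
  qed
  then have "(\<Sum>w\<in>W. cnt \<one> ws w) \<le> (\<Sum>w\<in>W. cnt \<one> vs w)" by (intro sum_mono)
  then show ?thesis using W sum_cnt_le[OF W(1), of \<one> vs] by linarith
qed

lemma len_le: "ws \<in> gwords V \<Longrightarrow> len (eval ws) \<le> length ws"
  unfolding len_def by (rule Least_le) auto

lemma tight_len:
  assumes "tight ws" "ws \<in> gwords V"
  shows "len (eval ws) = length ws"
  unfolding len_def using assms tight_length by (intro Least_equality) auto

lemma geo_len:
  assumes "geo I ws" "I \<subseteq> V" shows "len (eval ws) = length ws"
  using tight_len[OF geo_tight[OF assms]] assms gwords_mono[OF assms(2)] by (auto simp: geo_def)

lemma geo_exists:
  assumes "g \<in> par I"
  shows "\<exists>ws. geo I ws \<and> eval ws = g"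
proof -
  obtain vs where "vs \<in> gwords I \<and> eval vs = g" using assms by (auto simp: par_def)
  from ex_has_least_nat[of "\<lambda>ws. ws \<in> gwords I \<and> eval ws = g", OF this, of length]
  show ?thesis by (auto simp: geo_def)
qed

lemma geo_gwords: "geo I ws \<Longrightarrow> I \<subseteq> V \<Longrightarrow> ws \<in> gwords I \<and> ws \<in> gwords V"
  using gwords_mono[of I V] by (auto simp: geo_def)

lemma geo_append:
  assumes "geo I (us @ vs)" "I \<subseteq> V"
  shows "geo I us" "geo I vs"
proof -
  have m: "us \<in> gwords I" "vs \<in> gwords I" "us \<in> gwords V" "vs \<in> gwords V"
    using geo_gwords[OF assms] by auto
  note mono = gwords_mono[OF assms(2)]
  show "geo I us" unfolding geo_def
  proof (intro conjI ballI impI m)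
    fix us' assume "us' \<in> gwords I" "eval us' = eval us"
    then show "length us \<le> length us'" using geo_le[OF assms(1), of "us' @ vs"] m mono[of us']
      by (simp add: eval_append)
  qed
  show "geo I vs" unfolding geo_def
  proof (intro conjI ballI impI m)
    fix vs' assume "vs' \<in> gwords I" "eval vs' = eval vs"
    then show "length vs \<le> length vs'" using geo_le[OF assms(1), of "us @ vs'"] m mono[of vs']
      by (simp add: eval_append)
  qed
qed

text \<open>Gathering the crossings of \<open>wall \<one> x\<close> at the front costs no length in
  a tight word, and the block is not empty because \<open>x\<close> is a descent.\<close>

lemma desc_first_letter:
  assumes "geo I ws" "I \<subseteq> V" "x \<in> I" "x \<in> desc (eval ws)"
  shows "\<exists>b vs. geo I ((x, b) # vs) \<and> eval ((x, b) # vs) = eval ws"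
proof -
  have x: "x \<in> V" using assms by blast
  note m = geo_gwords[OF assms(1,2)] and t = geo_tight[OF assms(1,2)]
  define k where "k = cross \<one> ws (wall \<one> x)"
  obtain vs where vs: "vs \<in> gwords I" "eval ws = e x [^] k \<otimes> eval vs"
    "length vs + cnt \<one> ws (wall \<one> x) = length ws"
    using extract_first[OF conjunct1[OF m] assms(2) one_closed x] by (auto simp: k_def)
  have c: "cnt \<one> ws (wall \<one> x) = cyc (n x) k" using tightD[OF t one_closed] by (simp add: k_def)
  have nz: "cyc (n x) k \<noteq> 0" using assms(4) m by (simp add: desc_eval cyc_eq_0_iff k_def)
  obtain b where b: "e x [^] k = eval (replicate (cyc (n x) k) (x, b))" using syllable[OF x] by blast
  let ?r = "replicate (cyc (n x) k) (x, b)"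
  have r: "?r \<in> gwords I" "?r \<in> gwords V" using x assms(3) gwords_replicate by metis+
  have ev: "eval (?r @ vs) = eval ws" using vs r b gwords_mono[OF assms(2)] by (simp add: eval_append)
  have "geo I (?r @ vs)" using ev vs r c by (intro geo_transfer[OF assms(1)]) simp_all
  moreover have "?r @ vs = (x, b) # (replicate (cyc (n x) k - 1) (x, b) @ vs)" using nz by (cases "cyc (n x) k") auto
  ultimately show ?thesis using ev by metis
qed

text \<open>The first letter crosses \<open>wall \<one> x\<close>, and in a tight word a wall that
  is crossed has non-zero residue.\<close>

lemma first_letter_desc:
  assumes "tight ((x, b) # vs)" "(x, b) # vs \<in> gwords V"
  shows "x \<in> desc (eval ((x, b) # vs))"
  using desc_tight[OF assms(2,1)] assms(2) by simp

section \<open>Shortest coset representatives\<close>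

definition coset_min :: "'c set \<Rightarrow> 'a \<Rightarrow> bool" where
  "coset_min I u \<longleftrightarrow> (\<forall>h\<in>par I. len u \<le> len (h \<otimes> u))"

text \<open>The conjugate attached to \<open>wall h x\<close> lies in \<open>par I\<close>. Removing
  crossings of this wall from \<open>us\<close> would therefore lead to a shorter element of the
  same coset.\<close>

lemma coset_min_cnt:
  assumes "coset_min I (eval us)" "geo V us" "I \<subseteq> V" "g \<in> par I" "h \<in> par I" "x \<in> I"
  shows "cnt g us (wall h x) = 0"
proof -
  have c: "g \<in> carrier G" "h \<in> carrier G" "x \<in> V" using assms par_closed[OF assms(3)] by auto
  have us: "us \<in> gwords V" using geo_gwords[OF assms(2)] by simp
  define r where "r = h \<otimes> e x \<otimes> inv h"
  define k where "k = cross g us (wall h x)"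
  have r: "r \<in> par I" unfolding r_def
    using assms par_mult[OF assms(3)] par_inv[OF assms(3)] e_in_par[OF assms(3)] by simp
  have rc: "r \<in> carrier G" using par_closed[OF assms(3) r] .
  obtain vs where vs: "vs \<in> gwords V" "g \<otimes> eval us = r [^] k \<otimes> (g \<otimes> eval vs)"
    "length vs + cnt g us (wall h x) = length us"
    using extract_wall[OF us order_refl c] by (auto simp: r_def k_def)
  \<comment> \<open>Solves \<open>g \<otimes> eval us = r [^] k \<otimes> (g \<otimes> eval
    vs)\<close> for the factor carrying \<open>eval us\<close> to \<open>eval vs\<close>.\<close>
  define t where "t = inv g \<otimes> inv (r [^] k) \<otimes> g"
  have "t \<in> par I" unfolding t_def
    using assms par_mult[OF assms(3)] par_inv[OF assms(3)] par_int_pow[OF assms(3) r] by simp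
  moreover have "t \<otimes> eval us = eval vs"
  proof -
    have "t \<otimes> eval us = inv g \<otimes> (inv (r [^] k) \<otimes> (g \<otimes> eval us))"
      using c rc us by (simp add: t_def m_assoc)
    also have "\<dots> = eval vs" using c rc vs by (simp flip: m_assoc)
    finally show ?thesis .
  qed
  ultimately have "len (eval us) \<le> len (eval vs)" using assms(1) unfolding coset_min_def by auto
  then show ?thesis using geo_len[OF assms(2)] len_le[OF vs(1)] vs(3) by simp
qed

text \<open>The walls crossed by \<open>gs\<close> belong to \<open>par I\<close>, and
  \<open>us\<close> crosses none of these. Each wall is thus met by at most one of the two tight
  words.\<close>

lemma coset_min_tight:
  assumes "coset_min I (eval us)" "geo V us" "I \<subseteq> V" "geo I gs"
  shows "tight (gs @ us)"
  unfolding tight_def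
proof (intro ballI allI)
  fix p w assume p: "p \<in> carrier G"
  have m: "us \<in> gwords V" "gs \<in> gwords V" "gs \<in> gwords I"
    using geo_gwords[OF assms(2)] geo_gwords[OF assms(4,3)] by auto
  have t: "tight us" "tight gs" using geo_tight[OF assms(2)] geo_tight[OF assms(4,3)] by auto
  show "cnt p (gs @ us) w = cyc (wall_order w) (cross p (gs @ us) w)"
  proof (cases "cnt p gs w = 0")
    case True
    then show ?thesis using m p cross_eq_0[OF True] tightD[OF t(1), of "p \<otimes> eval gs"]
      by (simp add: cnt_append cross_append)
  next
    case False
    obtain hs a ts where s: "gs = hs @ a # ts" "wall (p \<otimes> eval hs) (fst a) = w"
      using cnt_split[OF False] m p by blast
    have hs: "hs \<in> gwords I" "fst a \<in> I" "fst a \<in> V" "hs \<in> gwords V" using m s by auto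
    \<comment> \<open>Translating by \<open>inv p\<close> puts both the starting point and the wall
      into the form required by \<open>coset_min_cnt\<close>.\<close>
    have "cnt (p \<otimes> eval gs) us w = cnt (eval gs) us (wall (eval hs) (fst a))"
      using cnt_left[of us "eval gs" "eval hs" p "fst a"] m p hs s by simp
    also have "\<dots> = 0"
      using coset_min_cnt[OF assms(1,2,3)] hs m by (auto simp: par_def)
    finally have z: "cnt (p \<otimes> eval gs) us w = 0" .
    then show ?thesis using m p cross_eq_0[OF z] tightD[OF t(2) p] by (simp add: cnt_append cross_append)
  qed
qed

lemma coset_min_len:
  assumes "coset_min I u" "u \<in> carrier G" "I \<subseteq> V" "g \<in> par I"
  shows "len (g \<otimes> u) = len g + len u"
proof -
  obtain us where us: "geo V us" "eval us = u" using geo_exists[of u V] assms(2) carrier_par by auto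
  obtain gs where gs: "geo I gs" "eval gs = g" using geo_exists[OF assms(4)] by auto
  have m: "us \<in> gwords V" "gs \<in> gwords V" using geo_gwords[OF us(1)] geo_gwords[OF gs(1) assms(3)] by auto
  have "tight (gs @ us)" using coset_min_tight us gs assms by blast
  then show ?thesis using tight_len[of "gs @ us"] m us gs geo_len[OF us(1)] geo_len[OF gs(1) assms(3)]
    by (simp add: eval_append)
qed

lemma coset_min_exists:
  assumes "w \<in> carrier G" "I \<subseteq> V"
  shows "\<exists>g\<in>par I. \<exists>u\<in>carrier G. w = g \<otimes> u \<and> coset_min I u"
proof -
  obtain h where h: "h \<in> par I" "\<And>h'. h' \<in> par I \<Longrightarrow> len (h \<otimes> w) \<le> len (h' \<otimes> w)"
    using ex_has_least_nat[of "\<lambda>h. h \<in> par I" \<one> "\<lambda>h. len (h \<otimes> w)"] one_in_par by blast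
  have hc: "h \<in> carrier G" using par_closed[OF assms(2) h(1)] .
  have "coset_min I (h \<otimes> w)" unfolding coset_min_def
  proof
    fix h' assume h': "h' \<in> par I"
    then show "len (h \<otimes> w) \<le> len (h' \<otimes> (h \<otimes> w))"
      using h(2)[OF par_mult[OF assms(2) h' h(1)]] par_closed[OF assms(2)] assms hc by (simp add: m_assoc)
  qed
  moreover have "w = inv h \<otimes> (h \<otimes> w)" using hc assms by (simp flip: m_assoc)
  ultimately show ?thesis using par_inv[OF assms(2) h(1)] hc assms by blast
qed

lemma len_one [simp]: "len \<one> = 0"
  using len_le[of "[]"] by simp

lemma len_eq_0: "g \<in> carrier G \<Longrightarrow> len g = 0 \<Longrightarrow> g = \<one>"
  using geo_exists[of g V] geo_len[of V] carrier_par by fastforce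

text \<open>A shortest representative crosses no wall of \<open>par I\<close>, in particular no
  \<open>wall \<one> x\<close>. Conversely, split \<open>u\<close> into a part in
  \<open>par I\<close> and a shortest one: the first letter of a non-empty geodesic for the former
  would be a descent of \<open>u\<close> in \<open>I\<close>.\<close>

lemma coset_min_iff:
  assumes "u \<in> carrier G" "I \<subseteq> V"
  shows "coset_min I u \<longleftrightarrow> desc u \<inter> I = {}"
proof
  assume c: "coset_min I u"
  obtain us where us: "geo V us" "eval us = u" using geo_exists[of u V] assms carrier_par by auto
  have "x \<notin> desc u" if "x \<in> I" for x
    using coset_min_cnt[of I us \<one> \<one> x] c us assms that desc_tight[OF _ geo_tight[OF us(1)]] geo_gwords[OF us(1)]
    by auto
  then show "desc u \<inter> I = {}" by blast
next
  assume d: "desc u \<inter> I = {}"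
  obtain g u' where g: "g \<in> par I" "u' \<in> carrier G" "u = g \<otimes> u'" "coset_min I u'"
    using coset_min_exists[OF assms] by blast
  obtain us where us: "geo V us" "eval us = u'" using geo_exists[of u' V] g carrier_par by auto
  obtain gs where gs: "geo I gs" "eval gs = g" using geo_exists[OF g(1)] by auto
  have m: "us \<in> gwords V" "gs \<in> gwords V" "gs \<in> gwords I"
    using geo_gwords[OF us(1)] geo_gwords[OF gs(1) assms(2)] by auto
  have t: "tight (gs @ us)" using coset_min_tight us gs g assms by blast
  show "coset_min I u"
  proof (cases gs)
    case Nil
    then show ?thesis using g gs by auto
  next
    case (Cons a gs')
    obtain x b where a: "a = (x, b)" by force
    have "x \<in> desc (eval (gs @ us))"
      using first_letter_desc[of x b "gs' @ us"] t m Cons a by simp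
    moreover have "eval (gs @ us) = u" using m us gs g by (simp add: eval_append)
    ultimately show ?thesis using d m Cons a by auto
  qed
qed

text \<open>For uniqueness, two descent-free elements of one coset are both shortest; by additivity
  of length the factor \<open>k\<close> between them has length 0.\<close>

lemma coset_decomp:
  assumes "I \<subseteq> J" "J \<subseteq> V"
  shows "bij_betw (\<lambda>(g, u). g \<otimes> u) (par I \<times> {u \<in> par J. desc u \<inter> I = {}}) (par J)"
  unfolding bij_betw_def
proof
  have I: "I \<subseteq> V" using assms by blast
  note cl = par_closed[OF I] par_closed[OF assms(2)]
  show "(\<lambda>(g, u). g \<otimes> u) ` (par I \<times> {u \<in> par J. desc u \<inter> I = {}}) = par J" (is "?L = _")
  proof
    show "?L \<subseteq> par J" using par_mult[OF assms(2)] par_mono[OF assms(1)] by auto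
    show "par J \<subseteq> ?L"
    proof
      fix w assume w: "w \<in> par J"
      obtain g u where g: "g \<in> par I" "u \<in> carrier G" "w = g \<otimes> u" "coset_min I u"
        using coset_min_exists[OF cl(2)[OF w] I] by blast
      then have "u = inv g \<otimes> w" using cl by (simp flip: m_assoc)
      moreover have "inv g \<in> par J" using par_inv[OF I g(1)] par_mono[OF assms(1)] by blast
      ultimately have "u \<in> par J" using w par_mult[OF assms(2)] by simp
      then show "w \<in> ?L" using g coset_min_iff[OF g(2) I] by (intro image_eqI[of _ _ "(g, u)"]) auto
    qed
  qed
  have "g = g' \<and> u = u'" if h: "g \<in> par I" "g' \<in> par I" "u \<in> par J" "u' \<in> par J"
    "desc u \<inter> I = {}" "desc u' \<inter> I = {}" "g \<otimes> u = g' \<otimes> u'" for g g' u u'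
  proof -
    have c: "g \<in> carrier G" "g' \<in> carrier G" "u \<in> carrier G" "u' \<in> carrier G" using h cl by auto
    define k where "k = inv g' \<otimes> g"
    have k: "k \<in> par I" "k \<in> carrier G" unfolding k_def using h par_mult[OF I] par_inv[OF I] c by auto
    have u': "u' = k \<otimes> u" using h(7) c by (simp add: k_def m_assoc inv_solve_left)
    then have u: "u = inv k \<otimes> u'" using c k by (simp flip: m_assoc)
    have min: "coset_min I u" "coset_min I u'" using coset_min_iff[OF _ I] h c by auto
    have "len u' \<le> len u" using min(2) par_inv[OF I k(1)] unfolding coset_min_def u[symmetric] by (metis u)
    moreover have "len u' = len k + len u" using coset_min_len[OF min(1) c(3) I k(1)] u' by simp
    ultimately have "k = \<one>" using len_eq_0[OF k(2)] by simp
    then show ?thesis using u' c by (metis h(7) l_one right_cancel)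
  qed
  then show "inj_on (\<lambda>(g, u). g \<otimes> u) (par I \<times> {u \<in> par J. desc u \<inter> I = {}})"
    by (auto simp: inj_on_def)
qed

lemma coset_len:
  assumes "I \<subseteq> V" "g \<in> par I" "u \<in> carrier G" "desc u \<inter> I = {}"
  shows "len (g \<otimes> u) = len g + len u"
  using coset_min_len[OF _ assms(3,1,2)] coset_min_iff[OF assms(3,1)] assms(4) by blast

text \<open>
  The exchange argument for the longest element of a Coxeter group: every geodesic of \<open>par J\<close> is an
  initial segment of a geodesic for \<open>w\<close>.
\<close>

lemma maximal_prefix:
  assumes "w \<in> carrier G" "J \<subseteq> V" "J \<subseteq> desc w" "\<And>x. x \<in> J \<Longrightarrow> n x = 2" "geo J gs"
  shows "\<exists>vs\<in>gwords V. w = eval gs \<otimes> eval vs \<and> len w = length gs + length vs"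
  using assms(5)
proof (induction gs)
  case Nil
  obtain ws where "geo V ws" "eval ws = w" using geo_exists[of w V] assms carrier_par by auto
  then show ?case using geo_len[of V ws] geo_gwords[of V ws] assms(1) by (intro bexI[of _ ws]) auto
next
  case (Cons a gs)
  obtain x b where a: "a = (x, b)" by force
  have geo: "geo J gs" using geo_append(2)[of J "[a]" gs] Cons.prems assms(2) by simp
  have x: "x \<in> J" "x \<in> V" "n x = 2" and gs: "gs \<in> gwords V" "gs \<in> gwords J" "eval gs \<in> carrier G"
    using geo_gwords[OF Cons.prems assms(2)] assms(4) a by auto
  have ex: "e x \<in> carrier G" using x e_closed by simp
  obtain vs where vs: "vs \<in> gwords V" "w = eval gs \<otimes> eval vs" "len w = length gs + length vs"
    using Cons.IH[OF geo] by blast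
  let ?w = "wall \<one> x"
  \<comment> \<open>Otherwise \<open>gs\<close> could be rewritten to start with \<open>x\<close>,
    and the involution \<open>e x\<close> would cancel, so that \<open>a # gs\<close> would not be
    geodesic.\<close>
  have "x \<notin> desc (eval gs)"
  proof
    assume "x \<in> desc (eval gs)"
    from desc_first_letter[OF geo assms(2) x(1) this] obtain c hs where
      hs: "geo J ((x, c) # hs)" "eval ((x, c) # hs) = eval gs" by blast
    have hsJ: "hs \<in> gwords J" "hs \<in> gwords V" using geo_gwords[OF hs(1) assms(2)] by auto
    have "letter (x, b) = letter (x, \<not> c)"
      using x e_pow_cong[of x "sg b" "sg (\<not> c)"] by (simp add: letter_def sg_def)
    then have "eval ((x, b) # gs) = letter (x, \<not> c) \<otimes> (letter (x, c) \<otimes> eval hs)"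
      using hs(2) by simp
    also have "\<dots> = eval hs"
      using letter_inverse[OF x(2), of "\<not> c"] hsJ x by (simp flip: m_assoc)
    finally have "length (a # gs) \<le> length hs" using geo_le[OF Cons.prems hsJ(1)] a by simp
    moreover have "length ((x, c) # hs) = length gs"
      using geo_len[OF hs(1) assms(2)] geo_len[OF geo assms(2)] hs(2) by simp
    ultimately show False by simp
  qed
  then have c0: "cnt \<one> gs ?w = 0"
    using desc_tight[OF gs(1) geo_tight[OF geo assms(2)]] x by simp
  have wv: "w = eval (gs @ vs)" using vs gs by (simp add: eval_append)
  define k where "k = cross (eval gs) vs ?w"
  \<comment> \<open>\<open>x\<close> is a descent of \<open>w\<close>, but \<open>gs\<close> does
    not cross its wall, so the odd number of crossings lies within \<open>vs\<close>.\<close>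
  have "cross \<one> (gs @ vs) ?w mod int (n x) \<noteq> 0"
    using desc_eval[of "gs @ vs" x] wv assms(3) x gs vs by auto
  then have k: "k mod 2 \<noteq> 0"
    using cross_eq_0[OF c0] gs vs x by (simp add: cross_append k_def)
  obtain us where us: "us \<in> gwords V"
    "eval gs \<otimes> eval vs = (\<one> \<otimes> e x \<otimes> inv \<one>) [^] k \<otimes> (eval gs \<otimes> eval us)"
    "length us + cnt (eval gs) vs ?w = length vs"
    using extract_wall[OF vs(1) order_refl gs(3) one_closed x(2)] by (auto simp: k_def)
  have "cnt (eval gs) vs ?w \<noteq> 0" using k cross_eq_0[of "eval gs" vs ?w] unfolding k_def by fastforce
  then have l: "length us < length vs" using us(3) by simp
  \<comment> \<open>The crossings removed from \<open>vs\<close> reappear in front as the single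
    letter \<open>a\<close>.\<close>
  have "e x [^] k = letter (x, b)"
    using e_pow_cong[OF x(2), of k "sg b"] k x(3) by (auto simp: letter_def sg_def)
  then have weq: "w = eval (a # gs) \<otimes> eval us"
    using vs us gs x ex a by (simp add: m_assoc)
  then have "w = eval (a # gs @ us)" using gs us x a by (simp add: eval_append m_assoc)
  then have "len w \<le> length (a # gs @ us)" using len_le[of "a # gs @ us"] gs us x a by simp
  then have "len w = length (a # gs) + length us" using l vs(3) by simp
  then show ?case using weq us(1) by blast
qed

text \<open>By \<open>maximal_prefix\<close> each of the two is an initial part of the other, so the
  lengths agree and the remaining factor is empty.\<close>

lemma maximal_unique:
  assumes "w \<in> par J" "w' \<in> par J" "J \<subseteq> V" "J \<subseteq> desc w" "J \<subseteq> desc w'" "\<And>x. x \<in> J \<Longrightarrow> n x = 2"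
  shows "w = w'"
proof -
  have c: "w \<in> carrier G" "w' \<in> carrier G" using assms par_closed[OF assms(3)] by auto
  have *: "\<exists>vs\<in>gwords V. u = u' \<otimes> eval vs \<and> len u = len u' + length vs"
    if u: "u \<in> carrier G" "u' \<in> par J" "J \<subseteq> desc u" for u u'
  proof -
    obtain gs where gs: "geo J gs" "eval gs = u'" using geo_exists[OF u(2)] by blast
    then show ?thesis using maximal_prefix[OF u(1) assms(3) u(3) assms(6) gs(1)] geo_len[OF gs(1) assms(3)] by simp
  qed
  obtain vs where vs: "w = w' \<otimes> eval vs" "len w = len w' + length vs"
    using *[OF c(1) assms(2,4)] by blast
  obtain vs' where vs': "w' = w \<otimes> eval vs'" "len w' = len w + length vs'"
    using *[OF c(2) assms(1,5)] by blast
  have "vs = []" using vs(2) vs'(2) by simp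
  then show ?thesis using vs(1) c by simp
qed

text \<open>The tag of the wall recovers the generator, and the coset containing
  \<open>\<one>\<close> is \<open>par (C y)\<close> itself.\<close>

lemma wall_one_eq:
  assumes "wall p x = wall \<one> y" "n y \<noteq> 2" "p \<in> carrier G" "y \<in> V"
  shows "x = y \<and> p \<in> par (C y)"
proof -
  have n: "n x \<noteq> 2" "x = y" "(\<lambda>c. p \<otimes> c) ` par (C y) = (\<lambda>c. \<one> \<otimes> c) ` par (C y)"
    using assms by (auto simp: wall_def split: if_splits)
  have "p \<in> (\<lambda>c. p \<otimes> c) ` par (C y)" using assms(3) one_in_par by (metis imageI r_one)
  then show ?thesis using n assms par_closed[OF star_sub[OF assms(4)]] by auto
qed

text \<open>
  A geodesic for \<open>w\<close> starting with \<open>y\<close> crosses the wall of \<open>x\<close> after a prefix lying in \<open>par (C x)\<close>. This prefix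
  crosses the wall of \<open>y\<close>, so \<open>e y\<close> is conjugate within \<open>par (C x)\<close> to one of its generators.
\<close>

lemma desc_commute:
  assumes "w \<in> carrier G" "x \<in> desc w" "y \<in> desc w" "n x \<noteq> 2"
  shows "e y \<otimes> e x = e x \<otimes> e y"
proof (cases "x = y")
  case False
  have xy: "x \<in> V" "y \<in> V" using assms by (auto simp: desc_def)
  obtain ws where ws: "geo V ws" "eval ws = w" using geo_exists[of w V] assms carrier_par by auto
  obtain b vs where vs: "geo V ((y, b) # vs)" "eval ((y, b) # vs) = w"
    using desc_first_letter[OF ws(1) order_refl xy(2)] assms ws by auto
  let ?ws = "(y, b) # vs"
  have m: "?ws \<in> gwords V" using geo_gwords[OF vs(1)] by blast
  have "cnt \<one> ?ws (wall \<one> x) \<noteq> 0"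
    using desc_tight[OF m geo_tight[OF vs(1)], of x] vs(2) assms(2) by (simp del: cnt.simps eval.simps)
  from cnt_split[OF this] m obtain us a ts where s: "?ws = us @ a # ts" "wall (\<one> \<otimes> eval us) (fst a) = wall \<one> x"
    by blast
  have us: "us \<in> gwords V" "eval us \<in> carrier G" using m s(1) by (metis gwords_append eval_closed)+
  have p: "fst a = x" "eval us \<in> par (C x)"
    using wall_one_eq[of "eval us" "fst a" x] s us assms(4) xy by auto
  \<comment> \<open>The word starts with \<open>y\<close>, whereas the crossing letter
    \<open>a\<close> belongs to \<open>x\<close>.\<close>
  have "us \<noteq> []" using s(1) p(1) False by auto
  then obtain us' where us': "us = (y, b) # us'" using s(1) by (cases us) auto
  have "geo V us" using geo_append(1)[of V us "a # ts"] vs(1) s(1) by simp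
  then have "y \<in> desc (eval us)"
    using first_letter_desc[of y b us'] geo_tight us us' by blast
  \<comment> \<open>Descents depend on the element only, so its spelling over \<open>C x\<close>
    must cross the wall of \<open>y\<close> as well.\<close>
  moreover obtain cs where cs: "cs \<in> gwords (C x)" "eval us = eval cs" using p(2) by (auto simp: par_def)
  moreover have csV: "cs \<in> gwords V" using gwords_mono[OF star_sub[OF xy(1)] cs(1)] .
  ultimately have "cross \<one> cs (wall \<one> y) \<noteq> 0" using desc_eval[OF csV, of y] by auto
  then have "cnt \<one> cs (wall \<one> y) \<noteq> 0" using cross_eq_0 by blast
  from cnt_split[OF this] csV obtain hs z rs where
    h: "cs = hs @ z # rs" "wall (\<one> \<otimes> eval hs) (fst z) = wall \<one> y" by blast
  have hm: "hs \<in> gwords (C x)" "fst z \<in> C x" "hs \<in> gwords V" "fst z \<in> V" using h cs csV by auto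
  have hp: "eval hs \<in> par (C x)" using hm by (auto simp: par_def)
  have "eval hs \<otimes> e (fst z) \<otimes> inv (eval hs) = e y"
    using wall_conj[OF h(2)] hm xy e_closed by simp
  moreover have "eval hs \<otimes> e (fst z) \<otimes> inv (eval hs) \<in> par (C x)"
    using par_mult[OF star_sub[OF xy(1)]] par_inv[OF star_sub[OF xy(1)]] hp
      e_in_par[OF star_sub[OF xy(1)] hm(2)] by blast
  ultimately show ?thesis using star_par_commute[OF xy(1)] by simp
qed simp

section \<open>Cyclic factors\<close>

lemma par_singleton:
  assumes "x \<in> V"
  shows "par {x} = range (\<lambda>k::int. e x [^] k)"
proof
  have "eval ws \<in> range (\<lambda>k::int. e x [^] k)" if "ws \<in> gwords {x}" for ws
    using that
  proof (induction ws)
    case Nil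
    then show ?case by (auto intro: range_eqI[of _ _ 0])
  next
    case (Cons a ws)
    then obtain k :: int where "eval ws = e x [^] k" by auto
    then show ?case using Cons.prems e_closed[OF assms]
      by (auto simp: letter_def int_pow_mult intro!: range_eqI[of _ _ "sg (snd a) + k"])
  qed
  then show "par {x} \<subseteq> range (\<lambda>k::int. e x [^] k)" by (auto simp: par_def)
  have "e x [^] k \<in> par {x}" for k :: int
    using par_int_pow[of "{x}" "e x" k] e_in_par[of "{x}" x] assms by simp
  then show "range (\<lambda>k::int. e x [^] k) \<subseteq> par {x}" by auto
qed

text \<open>A power of \<open>e x\<close> has a spelling that crosses only
  \<open>wall \<one> x\<close>, and for \<open>n x \<noteq> 2\<close> the tag of this wall
  determines \<open>x\<close>.\<close>

lemma desc_e_pow: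
  assumes "x \<in> V" "n x \<noteq> 2"
  shows "desc (e x [^] (k::int)) \<subseteq> {x}"
proof
  fix y assume y: "y \<in> desc (e x [^] k)"
  obtain b where b: "e x [^] k = eval (replicate (cyc (n x) k) (x, b))" using syllable[OF assms(1)] by blast
  have m: "replicate (cyc (n x) k) (x, b) \<in> gwords V" using gwords_replicate[OF assms(1)] .
  have "wall \<one> x = wall \<one> y"
  proof (rule ccontr)
    assume "wall \<one> x \<noteq> wall \<one> y"
    then show False using desc_eval[OF m, of y] y cross_replicate[OF assms(1) one_closed, of "cyc (n x) k" b "wall \<one> y"] b
      by simp
  qed
  then show "y \<in> {x}" using assms by (auto simp: wall_def split: if_splits)
qed

text \<open>Powers of \<open>e x\<close> can be moved to the right end of any word over
  \<open>J\<close>, and they have no descent in \<open>J - {x}\<close>; uniqueness in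
  \<open>coset_decomp\<close> does the rest.\<close>

lemma central_factor:
  assumes "J \<subseteq> V" "x \<in> J" "n x \<noteq> 2" "\<And>y. y \<in> J \<Longrightarrow> e y \<otimes> e x = e x \<otimes> e y"
  shows "{u \<in> par J. desc u \<inter> (J - {x}) = {}} = par {x}"
proof
  have x: "x \<in> V" "e x \<in> carrier G" "J - {x} \<subseteq> V" using assms e_closed by auto
  show "par {x} \<subseteq> {u \<in> par J. desc u \<inter> (J - {x}) = {}}"
    using par_mono[of "{x}" J] assms(2) par_singleton[OF x(1)] desc_e_pow[OF x(1) assms(3)] by auto
  have dec: "\<exists>g\<in>par (J - {x}). \<exists>k::int. eval ws = g \<otimes> e x [^] k" if "ws \<in> gwords J" for ws
    using that
  proof (induction ws)
    case Nil
    then show ?case by (intro bexI[of _ \<one>] exI[of _ 0]) auto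
  next
    case (Cons a ws)
    then obtain g and k :: int where g: "g \<in> par (J - {x})" "eval ws = g \<otimes> e x [^] k" by auto
    have gc: "g \<in> carrier G" using par_closed[OF x(3) g(1)] .
    have a: "fst a \<in> J" "fst a \<in> V" using Cons.prems assms by auto
    show ?case
    proof (cases "fst a = x")
      case True
      have "g \<otimes> e x = e x \<otimes> g"
        using par_commute[OF x(3,2) _ g(1)] assms(4) by blast
      then have "letter a \<otimes> g = g \<otimes> letter a"
        using letter_commute[OF x(1) gc, of "snd a"] True by (metis prod.collapse)
      then have "eval (a # ws) = g \<otimes> e x [^] (sg (snd a) + k)"
        using g gc True x by (simp add: int_pow_mult letter_def flip: m_assoc)
      then show ?thesis using g by blast
    next
      case False
      have "letter a \<otimes> g \<in> par (J - {x})"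
        using par_mult[OF x(3) _ g(1)] letter_in_par[OF x(3), of "fst a" "snd a"] False a by simp
      moreover have "eval (a # ws) = letter a \<otimes> g \<otimes> e x [^] k"
        using g gc a x by (simp add: m_assoc)
      ultimately show ?thesis by blast
    qed
  qed
  show "{u \<in> par J. desc u \<inter> (J - {x}) = {}} \<subseteq> par {x}"
  proof
    fix u assume "u \<in> {u \<in> par J. desc u \<inter> (J - {x}) = {}}"
    then have u: "u \<in> par J" "desc u \<inter> (J - {x}) = {}" by auto
    obtain g and k :: int where g: "g \<in> par (J - {x})" "u = g \<otimes> e x [^] k"
      using dec u(1) unfolding par_def by blast
    have xk: "e x [^] k \<in> {u \<in> par J. desc u \<inter> (J - {x}) = {}}"
      using par_int_pow[OF assms(1) e_in_par[OF assms(1,2)]] desc_e_pow[OF x(1) assms(3)] by auto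
    have uc: "u \<in> carrier G" using par_closed[OF assms(1) u(1)] .
    have "inj_on (\<lambda>(g, u). g \<otimes> u) (par (J - {x}) \<times> {u \<in> par J. desc u \<inter> (J - {x}) = {}})"
      using coset_decomp[of "J - {x}" J] assms(1) by (auto simp: bij_betw_def)
    \<comment> \<open>Compares the decompositions \<open>\<one> \<otimes> u\<close> and
      \<open>g \<otimes> e x [^] k\<close> of the same element.\<close>
    from inj_onD[OF this, of "(\<one>, u)" "(g, e x [^] k)"] have "u = e x [^] k"
      using g u uc xk by auto
    then show "u \<in> par {x}" using par_singleton[OF x(1)] by auto
  qed
qed

text \<open>Modulo 0 the residue is the integer itself, so the crossings of
  \<open>wall \<one> x\<close> determine the exponent.\<close>

lemma len_infinite:
  assumes "x \<in> V" "n x = 0"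
  shows "len (e x [^] (k::int)) = nat \<bar>k\<bar>" "e x [^] k = e x [^] l \<longleftrightarrow> k = l"
proof -
  have rep: "e x [^] k = eval (replicate (nat \<bar>k\<bar>) (x, k \<ge> 0))" for k :: int
    using assms(1) by (auto simp: eval_replicate sg_def)
  have m: "replicate j (x, b) \<in> gwords V" for j b using gwords_replicate[OF assms(1)] .
  have cr: "cross p (replicate (nat \<bar>k\<bar>) (x, k \<ge> 0)) w = (if wall p x = w then k else 0)" 
    if "p \<in> carrier G" for k p w
    using cross_replicate[OF assms(1) that, of "nat \<bar>k\<bar>" "k \<ge> 0" w] by (auto simp: sg_def)
  have "tight (replicate (nat \<bar>k\<bar>) (x, k \<ge> 0))"
    unfolding tight_def
  proof (intro ballI allI)
    fix p w assume p: "p \<in> carrier G"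
    show "cnt p (replicate (nat \<bar>k\<bar>) (x, k \<ge> 0)) w = cyc (wall_order w) (cross p (replicate (nat \<bar>k\<bar>) (x, k \<ge> 0)) w)"
      using cr[OF p, of k w] cross_replicate[OF assms(1) p, of "nat \<bar>k\<bar>" "k \<ge> 0" w] assms(2)
      by (cases "wall p x = w") (auto simp: cyc_def)
  qed
  from tight_len[OF this m] show "len (e x [^] k) = nat \<bar>k\<bar>" by (simp add: rep[of k])
  show "e x [^] k = e x [^] l \<longleftrightarrow> k = l"
  proof
    assume "e x [^] k = e x [^] l"
    then have "eval (replicate (nat \<bar>k\<bar>) (x, k \<ge> 0)) = eval (replicate (nat \<bar>l\<bar>) (x, l \<ge> 0))"
      using rep by simp
    from cross_cong[OF m m this one_closed, of "wall \<one> x"] show "k = l"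
      using cr[OF one_closed, of _ "wall \<one> x"] assms(2) by simp
  qed simp
qed

end

section \<open>Generating functions\<close>

text \<open>Quotients are taken in the fraction field of \<open>int fps\<close>, where division by
  series that are not units is possible.\<close>

definition rational_fps :: "int fps fract set" where
  "rational_fps = {to_fract (fps_of_poly p) / to_fract (fps_of_poly q) |p q. q \<noteq> 0}"

lemma fps_of_poly_eq_0_iff: "fps_of_poly p = 0 \<longleftrightarrow> p = 0"
  using fps_of_poly_eq_iff[of p 0] by simp

lemma rational_fps_poly: "to_fract (fps_of_poly p) \<in> rational_fps"
  unfolding rational_fps_def by (rule CollectI, rule exI[of _ p], rule exI[of _ 1]) simp

lemma rational_fps_add:
  assumes "a \<in> rational_fps" "b \<in> rational_fps"
  shows "a + b \<in> rational_fps"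
proof -
  obtain p q r s where "q \<noteq> 0" "s \<noteq> 0" "a = to_fract (fps_of_poly p) / to_fract (fps_of_poly q)"
    "b = to_fract (fps_of_poly r) / to_fract (fps_of_poly s)"
    using assms unfolding rational_fps_def by blast
  then have "a + b = to_fract (fps_of_poly (p * s + r * q)) / to_fract (fps_of_poly (q * s))"
    by (simp add: fps_of_poly_mult fps_of_poly_add add_frac_eq fps_of_poly_eq_0_iff)
  then show ?thesis using \<open>q \<noteq> 0\<close> \<open>s \<noteq> 0\<close> unfolding rational_fps_def
    by (metis (mono_tags, lifting) CollectI no_zero_divisors)
qed

lemma rational_fps_mult:
  assumes "a \<in> rational_fps" "b \<in> rational_fps"
  shows "a * b \<in> rational_fps"
proof -
  obtain p q r s where "q \<noteq> 0" "s \<noteq> 0" "a = to_fract (fps_of_poly p) / to_fract (fps_of_poly q)"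
    "b = to_fract (fps_of_poly r) / to_fract (fps_of_poly s)"
    using assms unfolding rational_fps_def by blast
  then have "a * b = to_fract (fps_of_poly (p * r)) / to_fract (fps_of_poly (q * s))"
    by (simp add: fps_of_poly_mult)
  then show ?thesis using \<open>q \<noteq> 0\<close> \<open>s \<noteq> 0\<close> unfolding rational_fps_def
    by (metis (mono_tags, lifting) CollectI no_zero_divisors)
qed

lemma rational_fps_inverse:
  assumes "a \<in> rational_fps"
  shows "inverse a \<in> rational_fps"
proof -
  obtain p q where pq: "q \<noteq> 0" "a = to_fract (fps_of_poly p) / to_fract (fps_of_poly q)"
    using assms unfolding rational_fps_def by blast
  show ?thesis
  proof (cases "p = 0")
    case True
    then show ?thesis using pq rational_fps_poly[of 0] by simp
  next
    case False
    then show ?thesis using pq unfolding rational_fps_def by (auto simp: inverse_divide)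
  qed
qed

lemma rational_fps_sum: "(\<And>i. i \<in> A \<Longrightarrow> h i \<in> rational_fps) \<Longrightarrow> sum h A \<in> rational_fps"
  by (induction A rule: infinite_finite_induct)
    (use rational_fps_poly[of 0] in \<open>auto intro: rational_fps_add\<close>)

text \<open>Expanding a product of factors \<open>-1 + 1\<close> over \<open>A\<close> gives one
  signed term for each subset.\<close>

lemma sum_Pow_alternating:
  assumes "finite A"
  shows "(\<Sum>I\<in>Pow A. (-1::int) ^ card I) = (if A = {} then 1 else 0)"
proof -
  have "(\<Sum>I\<in>Pow A. (-1::int) ^ card I) = (\<Prod>x\<in>A. -1 + 1)"
    by (subst prod_add[OF assms]) simp
  also have "\<dots> = (if A = {} then 1 else 0)" using assms by (simp add: card_gt_0_iff)
  finally show ?thesis .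
qed

lemma sum_if_card:
  "finite S \<Longrightarrow> (\<Sum>w\<in>S. if P w then c else 0) = c * int (card {w \<in> S. P w})"
  by (simp add: mult.commute flip: sum.inter_filter)

section \<open>Length series of sets of elements\<close>

context wall_system
begin

definition len_gf :: "'a set \<Rightarrow> int fps" where
  "len_gf A = Abs_fps (\<lambda>k. int (card {g \<in> A. len g = k}))"

lemma len_gf_nth [simp]: "fps_nth (len_gf A) k = int (card {g \<in> A. len g = k})"
  by (simp add: len_gf_def)

text \<open>Makes the coefficients of \<open>len_gf\<close> genuine counts, as \<open>card\<close>
  is 0 on infinite sets.\<close>

lemma finite_sphere:
  assumes "A \<subseteq> carrier G"
  shows "finite {g \<in> A. len g = k}"
proof (rule finite_subset)
  have "\<exists>ws. set ws \<subseteq> V \<times> UNIV \<and> length ws = len g \<and> g = eval ws" if "g \<in> carrier G" for g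
  proof -
    obtain ws where "geo V ws" "eval ws = g" using geo_exists[of g V] \<open>g \<in> carrier G\<close> carrier_par by auto
    then show ?thesis using geo_len[of V ws] geo_gwords[of V ws] by (auto simp: gwords_def)
  qed
  then show "{g \<in> A. len g = k} \<subseteq> eval ` {ws. set ws \<subseteq> V \<times> UNIV \<and> length ws = k}"
    using assms by blast
  show "finite (eval ` {ws. set ws \<subseteq> V \<times> UNIV \<and> length ws = k})"
    using finite_V by (intro finite_imageI finite_lists_length_eq) simp
qed

lemma len_gf_product:
  assumes "A \<subseteq> carrier G" "B \<subseteq> carrier G" "bij_betw (\<lambda>(g, u). g \<otimes> u) (A \<times> B) X"
    "\<And>g u. g \<in> A \<Longrightarrow> u \<in> B \<Longrightarrow> len (g \<otimes> u) = len g + len u"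
  shows "len_gf X = len_gf A * len_gf B"
proof (rule fps_ext)
  fix k
  let ?A = "\<lambda>i. {g \<in> A. len g = i}" and ?B = "\<lambda>i. {g \<in> B. len g = i}"
  let ?P = "\<Union>i\<in>{0..k}. ?A i \<times> ?B (k - i)"
  have "bij_betw (\<lambda>(g, u). g \<otimes> u) ?P {g \<in> X. len g = k}"
  proof (rule bij_betw_subset[OF assms(3)])
    show "(\<lambda>(g, u). g \<otimes> u) ` ?P = {g \<in> X. len g = k}"
    proof
      show "{g \<in> X. len g = k} \<subseteq> (\<lambda>(g, u). g \<otimes> u) ` ?P"
      proof
        fix w assume w: "w \<in> {g \<in> X. len g = k}"
        then obtain g u where "g \<in> A" "u \<in> B" "w = g \<otimes> u" using assms(3) by (auto simp: bij_betw_def)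
        then show "w \<in> (\<lambda>(g, u). g \<otimes> u) ` ?P"
          using w assms(4)[of g u] by (intro image_eqI[of _ _ "(g, u)"]) auto
      qed
    qed (use assms(3,4) in \<open>auto simp: bij_betw_def\<close>)
  qed auto
  then have "card {g \<in> X. len g = k} = card ?P" by (rule bij_betw_same_card[symmetric])
  also have "\<dots> = (\<Sum>i\<in>{0..k}. card (?A i \<times> ?B (k - i)))"
    using finite_sphere[OF assms(1)] finite_sphere[OF assms(2)] by (intro card_UN_disjoint) auto
  finally show "fps_nth (len_gf X) k = fps_nth (len_gf A * len_gf B) k"
    by (simp add: fps_mult_nth card_cartesian_product)
qed

lemma len_gf_finite:
  assumes "finite A"
  shows "\<exists>p. len_gf A = fps_of_poly p"
proof -
  have "\<forall>\<^sub>\<infinity>k. int (card {g \<in> A. len g = k}) = 0"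
  proof (rule MOST_nat[THEN iffD2], rule exI[of _ "Max (insert 0 (len ` A))"], intro allI impI)
    fix k assume k: "Max (insert 0 (len ` A)) < k"
    have "len g \<noteq> k" if "g \<in> A" for g
      using Max_ge[of "insert 0 (len ` A)" "len g"] k that assms by auto
    then have "{g \<in> A. len g = k} = {}" by blast
    then show "int (card {g \<in> A. len g = k}) = 0" by (simp only: card.empty of_nat_0)
  qed
  then have "len_gf A = fps_of_poly (Abs_poly (\<lambda>k. int (card {g \<in> A. len g = k})))"
    by (intro fps_ext) (simp add: Abs_poly_inverse)
  then show ?thesis by blast
qed

lemma rational_len_gf_finite: "finite A \<Longrightarrow> to_fract (len_gf A) \<in> rational_fps"
  using len_gf_finite rational_fps_poly by metis

lemma len_gf_par_nonzero: "I \<subseteq> V \<Longrightarrow> len_gf (par I) \<noteq> 0"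
proof
  assume I: "I \<subseteq> V" "len_gf (par I) = 0"
  have "\<one> \<in> {g \<in> par I. len g = 0}" by simp
  moreover have "finite {g \<in> par I. len g = 0}" using finite_sphere par_closed[OF I(1)] by blast
  ultimately have "card {g \<in> par I. len g = 0} \<noteq> 0" by (metis card_0_eq empty_iff)
  then show False using I(2) by (metis fps_zero_nth len_gf_nth of_nat_eq_0_iff)
qed

lemma len_gf_decomp:
  assumes "I \<subseteq> J" "J \<subseteq> V"
  shows "len_gf (par J) = len_gf (par I) * len_gf {u \<in> par J. desc u \<inter> I = {}}"
proof -
  have I: "I \<subseteq> V" using assms by blast
  show ?thesis
    using par_closed[OF I] par_closed[OF assms(2)] coset_len[OF I]
    by (intro len_gf_product[OF _ _ coset_decomp[OF assms]]) auto
qed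

text \<open>An element \<open>w\<close> is counted with sign for every
  \<open>I \<subseteq> J - desc w\<close>, and these signs cancel unless that set is empty.\<close>

lemma len_gf_alternating:
  assumes "J \<subseteq> V"
  shows "(\<Sum>I\<in>Pow J. (-1) ^ card I * len_gf {u \<in> par J. desc u \<inter> I = {}}) =
    len_gf {w \<in> par J. J \<subseteq> desc w}"
proof (rule fps_ext)
  fix k
  let ?S = "{w \<in> par J. len w = k}"
  have fJ: "finite J" using finite_subset[OF assms finite_V] .
  have fS: "finite ?S" using finite_sphere par_closed[OF assms] by blast
  have nth: "fps_nth ((-1) ^ j * (F :: int fps)) k = (-1) ^ j * fps_nth F k" for j F
    by (cases "even j") simp_all
  have "fps_nth (\<Sum>I\<in>Pow J. (-1) ^ card I * len_gf {u \<in> par J. desc u \<inter> I = {}}) k =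
      (\<Sum>I\<in>Pow J. (-1) ^ card I * int (card {w \<in> ?S. I \<subseteq> J - desc w}))"
    unfolding fps_sum_nth nth len_gf_nth
    by (intro sum.cong arg_cong2[where f = times] arg_cong[where f = "\<lambda>A. int (card A)"]) auto
  also have "\<dots> = (\<Sum>I\<in>Pow J. \<Sum>w\<in>?S. if I \<subseteq> J - desc w then (-1) ^ card I else 0)"
    by (simp only: sum_if_card[OF fS])
  also have "\<dots> = (\<Sum>w\<in>?S. \<Sum>I\<in>Pow J. if I \<subseteq> J - desc w then (-1) ^ card I else 0)"
    by (rule sum.swap)
  also have "\<dots> = (\<Sum>w\<in>?S. \<Sum>I\<in>Pow (J - desc w). (-1) ^ card I)"
  proof (rule sum.cong[OF HOL.refl])
    fix w
    have "Pow J \<inter> {I. I \<subseteq> J - desc w} = Pow (J - desc w)" by auto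
    then show "(\<Sum>I\<in>Pow J. if I \<subseteq> J - desc w then (-1::int) ^ card I else 0) = (\<Sum>I\<in>Pow (J - desc w). (-1) ^ card I)"
      using fJ by (simp add: sum.If_cases)
  qed
  also have "\<dots> = (\<Sum>w\<in>?S. if J \<subseteq> desc w then 1 else 0)"
    using fJ by (intro sum.cong HOL.refl) (auto simp: sum_Pow_alternating)
  also have "\<dots> = int (card {w \<in> ?S. J \<subseteq> desc w})"
    by (simp only: sum_if_card[OF fS] mult_1)
  also have "{w \<in> ?S. J \<subseteq> desc w} = {w \<in> {w \<in> par J. J \<subseteq> desc w}. len w = k}" by auto
  finally show "fps_nth (\<Sum>I\<in>Pow J. (-1) ^ card I * len_gf {u \<in> par J. desc u \<inter> I = {}}) k =
      fps_nth (len_gf {w \<in> par J. J \<subseteq> desc w}) k" by simp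
qed

section \<open>Rationality by induction on the set of generators\<close>

lemma desc_one: "desc \<one> = {}"
  using coset_min_iff[of \<one> V] by (auto simp: coset_min_def desc_def)

text \<open>Writing each series in the alternating sum as a quotient \<open>D J / D I\<close> gives
  a linear equation for \<open>D J\<close>, whose coefficient \<open>S\<close> involves proper
  subsets only and whose right side is a polynomial.\<close>

lemma rational_by_recursion:
  assumes "J \<subseteq> V" "J \<noteq> {}" "finite {w \<in> par J. J \<subseteq> desc w}"
    "\<And>I. I \<subset> J \<Longrightarrow> to_fract (len_gf (par I)) \<in> rational_fps"
  shows "to_fract (len_gf (par J)) \<in> rational_fps"
proof -
  define F where "F = len_gf {w \<in> par J. J \<subseteq> desc w}"
  define D where "D = (\<lambda>I. to_fract (len_gf (par I)))"
  \<comment> \<open>The term for \<open>I = J\<close> is left out: it is just the sign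
    \<open>(-1) ^ card J\<close>, which moves to the other side.\<close>
  define S where "S = (\<Sum>I\<in>Pow J - {J}. (-1) ^ card I * inverse (D I))"
  have fJ: "finite J" using finite_subset[OF assms(1) finite_V] .
  have D0: "D I \<noteq> 0" if "I \<subseteq> J" for I
    using len_gf_par_nonzero[of I] assms(1) that by (simp add: D_def)
  have quot: "to_fract (len_gf {u \<in> par J. desc u \<inter> I = {}}) = D J * inverse (D I)" if "I \<subseteq> J" for I
    using len_gf_decomp[OF that assms(1)] D0[OF that] by (simp add: D_def field_simps)
  have sgn: "to_fract ((-1) ^ j * A) = (-1) ^ j * to_fract A" for j and A :: "int fps"
    by (cases "even j") simp_all
  have "to_fract F = (\<Sum>I\<in>Pow J. (-1) ^ card I * (D J * inverse (D I)))"
    unfolding F_def len_gf_alternating[OF assms(1), symmetric] to_fract_sum sgn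
    by (intro sum.cong HOL.refl) (use quot in auto)
  also have "\<dots> = (-1) ^ card J * (D J * inverse (D J)) + (\<Sum>I\<in>Pow J - {J}. (-1) ^ card I * (D J * inverse (D I)))"
    using fJ by (intro sum.remove) auto
  also have "\<dots> = (-1) ^ card J + D J * S"
    using D0[of J] by (simp add: S_def sum_distrib_left mult.left_commute)
  finally have "D J * S = to_fract F - (-1) ^ card J" by simp
  also have "\<dots> = to_fract (F - (-1) ^ card J)" by (cases "even (card J)") simp_all
  finally have eq: "D J * S = to_fract (F - (-1) ^ card J)" .
  \<comment> \<open>The identity has no descents, so \<open>F\<close> has no constant term. The
    right side is then non-zero, and so is \<open>S\<close>.\<close>
  have "{g \<in> {w \<in> par J. J \<subseteq> desc w}. len g = 0} = {}"
    using len_eq_0 par_closed[OF assms(1)] desc_one assms(2) by blast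
  then have "fps_nth F 0 = 0" unfolding F_def len_gf_nth by (metis card.empty of_nat_0)
  then have "fps_nth (F - (-1) ^ card J) 0 \<noteq> 0" by (cases "even (card J)") simp_all
  then have nz: "F - (-1) ^ card J \<noteq> 0" by (metis fps_zero_nth)
  obtain p where p: "F = fps_of_poly p" using len_gf_finite[OF assms(3)] by (auto simp: F_def)
  have "F - (-1) ^ card J = fps_of_poly (p - (-1) ^ card J)"
    unfolding p by (cases "even (card J)") (simp_all add: fps_of_poly_diff fps_of_poly_add)
  then have R: "D J * S \<in> rational_fps" using eq rational_fps_poly by metis
  have "S \<in> rational_fps" unfolding S_def
  proof (intro rational_fps_sum rational_fps_mult rational_fps_inverse)
    fix I assume "I \<in> Pow J - {J}"
    then show "D I \<in> rational_fps" unfolding D_def by (intro assms(4)) auto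
    show "(-1) ^ card I \<in> rational_fps"
      using rational_fps_poly[of 1] rational_fps_poly[of "-1"]
      by (cases "even (card I)") (simp_all add: fps_of_poly_uminus)
  qed
  moreover have "S \<noteq> 0" using eq nz by auto
  ultimately have "D J = (D J * S) * inverse S" by simp
  then have "D J \<in> rational_fps"
    using rational_fps_mult[OF R rational_fps_inverse[OF \<open>S \<in> rational_fps\<close>]] by metis
  then show ?thesis by (simp only: D_def)
qed

text \<open>For \<open>n x = 0\<close> there are two elements of every positive length, and the
  series is \<open>(1 + t) / (1 - t)\<close>; otherwise the group is finite.\<close>

lemma rational_cyclic:
  assumes "x \<in> V"
  shows "to_fract (len_gf (par {x})) \<in> rational_fps"
proof (cases "n x = 0")
  case False
  have "par {x} \<subseteq> (\<lambda>k. e x [^] k) ` {0..<int (n x)}"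
  proof
    fix g assume "g \<in> par {x}"
    then obtain k :: int where "g = e x [^] k" using par_singleton[OF assms] by auto
    then have "g = e x [^] (k mod int (n x))" using e_pow_cong[OF assms, of k "k mod int (n x)"] by simp
    then show "g \<in> (\<lambda>k. e x [^] k) ` {0..<int (n x)}" using False by (intro image_eqI) auto
  qed
  then have "finite (par {x})" by (rule finite_subset) simp
  then show ?thesis by (rule rational_len_gf_finite)
next
  case True
  note len = len_infinite[OF assms True]
  have "{g \<in> par {x}. len g = k} = {e x [^] int k, e x [^] (- int k)}" for k
  proof
    show "{g \<in> par {x}. len g = k} \<subseteq> {e x [^] int k, e x [^] (- int k)}"
    proof
      fix g assume "g \<in> {g \<in> par {x}. len g = k}"
      then obtain j :: int where j: "g = e x [^] j" "nat \<bar>j\<bar> = k"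
        using len(1) par_singleton[OF assms] by auto
      then have "j = int k \<or> j = - int k" by linarith
      then show "g \<in> {e x [^] int k, e x [^] (- int k)}" using j by auto
    qed
  qed (simp add: par_singleton[OF assms] len(1))
  moreover have "card {e x [^] int k, e x [^] (- int k)} = (if k = 0 then 1 else 2)" for k
    using len(2)[of "int k" "- int k"] by (simp add: card_insert_if)
  ultimately have nth: "fps_nth (len_gf (par {x})) k = (if k = 0 then 1 else 2)" for k
    by (simp only: len_gf_nth) simp
  have "fps_of_poly [:1, -1:] * len_gf (par {x}) = fps_of_poly [:1, 1:]"
  proof (rule fps_ext)
    fix k
    have P: "fps_of_poly [:1, -1:] = (1 - fps_X :: int fps)"
      by (simp add: fps_of_poly_pCons)
    have "fps_nth ((1 - fps_X) * F) k = fps_nth F k - (if k = 0 then 0 else fps_nth F (k - 1))"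
      for F :: "int fps"
      by (simp add: left_diff_distrib)
    from this[of "len_gf (par {x})"]
    show "fps_nth (fps_of_poly [:1, -1:] * len_gf (par {x})) k = fps_nth (fps_of_poly [:1, 1:]) k"
      unfolding P nth by (simp add: coeff_pCons split: nat.split)
  qed
  then have "to_fract (fps_of_poly [:1, -1:]) * to_fract (len_gf (par {x})) = to_fract (fps_of_poly [:1, 1:])"
    by (simp flip: to_fract_mult)
  then have "to_fract (len_gf (par {x})) = to_fract (fps_of_poly [:1, 1:]) / to_fract (fps_of_poly [:1, -1:])"
    by (simp add: field_simps fps_of_poly_eq_0_iff del: fps_of_poly_eq_iff)
  then show ?thesis unfolding rational_fps_def
    by (intro CollectI exI[of _ "[:1, 1:]"] exI[of _ "[:1, -1:]"]) simp
qed

theorem rational_par: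
  assumes "J \<subseteq> V"
  shows "to_fract (len_gf (par J)) \<in> rational_fps"
  using finite_subset[OF assms finite_V] assms
proof (induction J rule: finite_psubset_induct)
  case (psubset J)
  have IH: "to_fract (len_gf (par I)) \<in> rational_fps" if "I \<subset> J" for I
    using psubset.IH[OF that] that psubset.prems by blast
  show ?case
  proof (cases "\<exists>x\<in>J. n x \<noteq> 2 \<and> (\<forall>y\<in>J. e y \<otimes> e x = e x \<otimes> e y)")
    case True
    then obtain x where x: "x \<in> J" "n x \<noteq> 2" "\<And>y. y \<in> J \<Longrightarrow> e y \<otimes> e x = e x \<otimes> e y" by blast
    have "len_gf (par J) = len_gf (par (J - {x})) * len_gf (par {x})"
      using len_gf_decomp[of "J - {x}" J] psubset.prems central_factor[OF psubset.prems x] by simp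
    moreover have "J - {x} \<subset> J" "x \<in> V" using x psubset.prems by auto
    ultimately show ?thesis using rational_fps_mult[OF IH rational_cyclic] by simp
  next
    case False
    let ?M = "{w \<in> par J. J \<subseteq> desc w}"
    have "finite ?M"
    proof (cases "\<forall>x\<in>J. n x = 2")
      case True
      then have "w = w'" if "w \<in> ?M" "w' \<in> ?M" for w w'
        using maximal_unique[of w J w'] that psubset.prems by simp
      then have "?M \<subseteq> {w}" if "w \<in> ?M" for w using that by blast
      then show ?thesis by (metis (no_types, lifting) finite.emptyI finite.insertI finite_subset subset_empty subsetI)
    next
      case nontrivial: False
      then obtain x y where "x \<in> J" "y \<in> J" "n x \<noteq> 2" "e y \<otimes> e x \<noteq> e x \<otimes> e y" using False by blast
      \<comment> \<open>Both \<open>x\<close> and \<open>y\<close> would be descents of any member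
        of \<open>?M\<close>, and hence would commute.\<close>
      then have "?M = {}" using desc_commute[of _ x y] par_closed[OF psubset.prems] by blast
      then show ?thesis by (metis finite.emptyI)
    qed
    \<comment> \<open>For empty \<open>J\<close> the identity lies in \<open>?M\<close>, so the
      constant term in the recursion could cancel.\<close>
    moreover have ?thesis if "J = {}"
    proof -
      have "par {} = {\<one>}" by (auto simp: par_def gwords_def)
      then show ?thesis using that rational_len_gf_finite[of "par {}"] by simp
    qed
    ultimately show ?thesis using rational_by_recursion[OF psubset.prems] IH by blast
  qed
qed

end

section \<open>Dyer groups\<close>

context dyer_graph
begin

definition gen :: "'a \<Rightarrow> 'a gword set" where
  "gen x = pres_rel V (dyer_relations V E m f) `` {[(x, True)]}"

text \<open>With \<open>0\<close> for infinite order the power relation becomes trivial and residues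
  become plain integers.\<close>

definition ord :: "'a \<Rightarrow> nat" where
  "ord x = (case f x of enat k \<Rightarrow> k | \<infinity> \<Rightarrow> 0)"

text \<open>Edges labelled \<open>m \<noteq> 2\<close> are left out, as their ends need not commute.\<close>

definition star :: "'a \<Rightarrow> 'a set" where
  "star x = insert x {y. {x, y} \<in> E \<and> m {x, y} = 2}"

abbreviation (input) "R \<equiv> dyer_relations V E m f"
abbreviation (input) "D \<equiv> dyer_group V E m f"
abbreviation (input) "cls w \<equiv> pres_rel V (dyer_relations V E m f) `` {w}"

section \<open>Classes of words as group elements\<close>

lemma mult_cls: "u \<in> gwords V \<Longrightarrow> v \<in> gwords V \<Longrightarrow> cls u \<otimes>\<^bsub>D\<^esub> cls v = cls (u @ v)"
  unfolding dyer_group_def by (rule presented_group_mult)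

lemma one_cls: "\<one>\<^bsub>D\<^esub> = cls []"
  unfolding dyer_group_def by (rule presented_group_one)

lemma cls_carrier: "w \<in> gwords V \<Longrightarrow> cls w \<in> carrier D"
  unfolding dyer_group_def by (rule pres_class_carrier)

lemma cls_eq_iff: "u \<in> gwords V \<Longrightarrow> v \<in> gwords V \<Longrightarrow> cls u = cls v \<longleftrightarrow> (u, v) \<in> pres_rel V R"
  using eq_equiv_class_iff[OF equiv_pres_rel] by metis

lemma cls_relation: "(r, s) \<in> R \<Longrightarrow> cls r = cls s"
  using pres_rel.relation[of r s R V "[]" "[]"] dyer_relations_gwords
  by (subst cls_eq_iff) auto

lemma group_D: "group D"
  unfolding dyer_group_def by (rule group_presented_group)

lemma gen_carrier: "x \<in> V \<Longrightarrow> gen x \<in> carrier D"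
  unfolding gen_def by (rule cls_carrier) simp

lemma gen_pow: "x \<in> V \<Longrightarrow> gen x [^]\<^bsub>D\<^esub> k = cls (replicate k (x, True))"
proof (induction k)
  case 0
  then show ?case by (simp add: one_cls)
next
  case (Suc k)
  have "cls (replicate k (x, True)) \<otimes>\<^bsub>D\<^esub> cls [(x, True)] = cls (replicate (Suc k) (x, True))"
    using Suc.prems by (subst mult_cls) (simp_all add: gwords_replicate replicate_append_same)
  then show ?case using Suc by (simp add: gen_def)
qed

lemma edge_V: "{x, y} \<in> E \<Longrightarrow> x \<in> V \<and> y \<in> V"
  using edge[of "{x, y}"] by simp

lemma walled_D: "walled_group D V gen ord star"
proof (intro walled_group.intro group_D walled_group_axioms.intro finite_V)
  fix x y assume x: "x \<in> V"
  show "gen x \<in> carrier D" using gen_carrier[OF x] .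
  show "gen x [^]\<^bsub>D\<^esub> ord x = \<one>\<^bsub>D\<^esub>"
  proof (cases "f x")
    case (enat k)
    then have "(replicate k (x, True), []) \<in> R" using x by (auto simp: dyer_relations_def)
    then show ?thesis using cls_relation[of "replicate k (x, True)" "[]"] enat
      by (simp add: gen_pow[OF x] ord_def one_cls)
  next
    case infinity
    then show ?thesis by (simp add: gen_pow[OF x] ord_def one_cls)
  qed
  show "star x \<subseteq> V" using x edge_V by (auto simp: star_def)
  show "x \<in> star x" by (simp add: star_def)
  assume y: "y \<in> star x"
  show "gen y \<otimes>\<^bsub>D\<^esub> gen x = gen x \<otimes>\<^bsub>D\<^esub> gen y"
  proof (cases "y = x")
    case False
    then have "{x, y} \<in> E" "m {x, y} = 2" using y by (auto simp: star_def)
    then have "(alt_word x y 2, alt_word y x 2) \<in> R" unfolding dyer_relations_def by force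
    then have "cls [(x, True), (y, True)] = cls [(y, True), (x, True)]"
      using cls_relation by (fastforce simp: numeral_2_eq_2)
    then show ?thesis using edge_V[OF \<open>{x, y} \<in> E\<close>] unfolding gen_def
      by (simp add: mult_cls)
  qed simp
qed

sublocale W: walled_group D V gen ord star
  by (rule walled_D)

lemma letter_cls: "x \<in> V \<Longrightarrow> W.letter (x, b) = cls [(x, b)]"
proof (cases b)
  case True
  assume "x \<in> V"
  then show ?thesis using True W.letter_True[of x] by (simp add: gen_def)
next
  case False
  assume x: "x \<in> V"
  have "cls [(x, False)] \<otimes>\<^bsub>D\<^esub> gen x = \<one>\<^bsub>D\<^esub>"
    unfolding gen_def using x pres_rel.cancel[of x V "[]" "[]" False R] 
    by (simp add: mult_cls one_cls cls_eq_iff)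
  then have "inv\<^bsub>D\<^esub> gen x = cls [(x, False)]"
    using x by (intro W.inv_equality gen_carrier cls_carrier) auto
  then show ?thesis using x False by (simp add: W.letter_def sg_def W.int_pow_neg gen_carrier)
qed

lemma eval_cls: "ws \<in> gwords V \<Longrightarrow> W.eval ws = cls ws"
proof (induction ws)
  case (Cons a ws)
  then show ?case by (cases a) (simp add: letter_cls mult_cls)
qed (simp add: one_cls)

lemma eval_pres_rel: "(u, v) \<in> pres_rel V R \<Longrightarrow> W.eval u = W.eval v"
  using pres_rel_gwords[of u v V R] by (simp add: eval_cls cls_eq_iff)

section \<open>Invariance of crossings under the relations\<close>

lemma ord_eq_2: "f x = 2 \<Longrightarrow> ord x = 2"
  by (simp add: ord_def numeral_eq_enat)

text \<open>A power relation crosses one wall as often as its order, hence 0 times modulo that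
  order. The edge relations preserve the crossing numbers exactly.\<close>

lemma cross_relation:
  assumes "(r, s) \<in> R" "p \<in> carrier D"
  shows "W.cross p r w mod int (W.wall_order w) = W.cross p s w mod int (W.wall_order w)"
proof -
  consider x k where "x \<in> V" "f x = enat k" "r = replicate k (x, True)" "s = []"
    | x y where "{x, y} \<in> E" "r = alt_word x y (m {x, y})" "s = alt_word y x (m {x, y})"
    using assms(1) unfolding dyer_relations_def by blast
  then show ?thesis
  proof cases
    case 1
    then have "ord x = k" by (simp add: ord_def)
    then show ?thesis using W.cross_replicate[OF 1(1) assms(2), of k True w] 1 by (auto simp: sg_def)
  next
    case 2
    have xy: "x \<in> V" "y \<in> V" using edge_V[OF 2(1)] by auto
    have "W.cross p r w = W.cross p s w"
    \<comment> \<open>With label 2 the generators may have any orders but lie in each other's stars;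
      any other label forces both orders to be 2.\<close>
    proof (cases "m {x, y} = 2")
      case True
      then have "y \<in> star x" "x \<in> star y" using 2(1) by (auto simp: star_def insert_commute)
      from W.cross_commute[OF xy this assms(2), of w] show ?thesis
        unfolding 2(2,3) True by (simp add: numeral_2_eq_2)
    next
      case False
      then have "ord x = 2" "ord y = 2" using m_neq_2[OF 2(1)] ord_eq_2 by auto
      moreover have "W.eval r = W.eval s"
        using eval_pres_rel[of r s] cls_relation[OF assms(1)] cls_eq_iff dyer_relations_gwords assms(1) by blast
      ultimately show ?thesis using W.cross_braid[OF xy] assms(2) unfolding 2 by blast
    qed
    then show ?thesis by simp
  qed
qed

text \<open>Both sides of a relation end at the same element, so the letters after them cross the
  same walls as before.\<close>

lemma cross_pres_rel:
  assumes "(u, v) \<in> pres_rel V R" "p \<in> carrier D"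
  shows "W.cross p u w mod int (W.wall_order w) = W.cross p v w mod int (W.wall_order w)"
  using assms
proof (induction arbitrary: p)
  case (cancel x u v b)
  let ?q = "p \<otimes>\<^bsub>D\<^esub> W.eval u"
  have q: "?q \<in> carrier D" using cancel by simp
  define c where "c = [(x, b), (x, \<not> b)]"
  have c: "c \<in> gwords V" using cancel by (simp add: c_def)
  \<comment> \<open>The letter and its inverse cross the same wall with opposite signs.\<close>
  have "W.wall (?q \<otimes>\<^bsub>D\<^esub> W.letter (x, b)) x = W.wall ?q x"
    using W.wall_pow[OF q cancel(1)] by (simp add: W.letter_def)
  then have "W.cross ?q c w = 0" by (simp add: sg_def c_def)
  moreover have "W.eval c = \<one>\<^bsub>D\<^esub>"
    using W.letter_inverse[OF cancel(1), of b] cancel(1) by (simp add: c_def)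
  ultimately have "W.cross p (u @ c @ v) w = W.cross p (u @ v) w"
    using cancel c q by (simp add: W.cross_append)
  then show ?case by (simp add: c_def)
next
  case (relation r s u v)
  let ?q = "p \<otimes>\<^bsub>D\<^esub> W.eval u" and ?m = "int (W.wall_order w)"
  have q: "?q \<in> carrier D" using relation by simp
  have e: "W.eval r = W.eval s"
    using eval_pres_rel[of r s] pres_rel.relation[of r s R V "[]" "[]"] relation by simp
  have "W.cross p (u @ t @ v) w = W.cross p u w + (W.cross ?q t w + W.cross (?q \<otimes>\<^bsub>D\<^esub> W.eval t) v w)"
    if "t \<in> gwords V" for t
    using relation q that by (simp add: W.cross_append)
  moreover have "W.cross ?q r w mod ?m = W.cross ?q s w mod ?m"
    using cross_relation[OF relation(1) q] .
  then have "(W.cross p u w + (W.cross ?q r w + z)) mod ?m = (W.cross p u w + (W.cross ?q s w + z)) mod ?m" for z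
    by (intro mod_add_cong HOL.refl)
  ultimately show ?case using relation(2,3) e by (simp only:)
next
  case (sym v w)
  show ?case by (rule HOL.sym[OF sym.IH[OF sym.prems]])
next
  case (trans u v w)
  show ?case by (rule HOL.trans[OF trans.IH(1)[OF trans.prems] trans.IH(2)[OF trans.prems]])
qed (rule HOL.refl)

sublocale W: wall_system D V gen ord star
proof unfold_locales
  show "carrier D = W.par V"
  proof -
    have "g \<in> carrier D \<longleftrightarrow> (\<exists>w\<in>gwords V. g = cls w)" for g
      unfolding dyer_group_def by (rule presented_group_carrier)
    then show ?thesis using eval_cls unfolding W.par_def by (auto simp: image_iff)
  qed
  fix us vs p w
  assume h: "us \<in> gwords V" "vs \<in> gwords V" "W.eval us = W.eval vs" "p \<in> carrier D"
  then have "(us, vs) \<in> pres_rel V R" using cls_eq_iff eval_cls by metis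
  from cross_pres_rel[OF this h(4)]
  show "W.cross p us w mod int (W.wall_order w) = W.cross p vs w mod int (W.wall_order w)" .
qed

text \<open>One length ranges over lists of group elements, the other over words in signed letters;
  \<open>W.letter\<close> translates between them.\<close>

lemma word_length_len: "word_length D (dyer_gens V E m f) g = W.len g"
proof -
  have gens: "dyer_gens V E m f = gen ` V"
    by (simp add: dyer_gens_def pres_gens_def gen_def)
  define S where "S = dyer_gens V E m f \<union> m_inv D ` dyer_gens V E m f"
  have letter_S: "W.letter a \<in> S" if "fst a \<in> V" for a
  proof (cases "snd a")
    case True
    then have "W.letter a = gen (fst a)" using that W.letter_True[of "fst a"] by (cases a) simp
    then show ?thesis using that unfolding S_def gens by blast
  next
    case False
    then have "W.letter a = inv\<^bsub>D\<^esub> (gen (fst a))"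
      using that by (simp add: W.letter_def sg_def W.int_pow_neg gen_carrier)
    then show ?thesis using that unfolding S_def gens by blast
  qed
  have S_letter: "\<exists>a. fst a \<in> V \<and> h = W.letter a" if h: "h \<in> S" for h
  proof -
    consider x where "x \<in> V" "h = gen x" | x where "x \<in> V" "h = inv\<^bsub>D\<^esub> (gen x)"
      using h unfolding S_def gens by blast
    then show ?thesis
    proof cases
      case 1
      then show ?thesis using W.letter_True[of x] by (intro exI[of _ "(x, True)"]) simp
    next
      case 2
      then show ?thesis
        by (intro exI[of _ "(x, False)"]) (simp add: W.letter_def sg_def W.int_pow_neg gen_carrier)
    qed
  qed
  have to: "set (map W.letter ws) \<subseteq> S \<and> foldr (\<otimes>\<^bsub>D\<^esub>) (map W.letter ws) \<one>\<^bsub>D\<^esub> = W.eval ws"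
    if "ws \<in> gwords V" for ws
    using that
  proof (induction ws)
    case (Cons a ws)
    then show ?case using letter_S[of a] by simp
  qed simp
  have from_S: "\<exists>ws\<in>gwords V. hs = map W.letter ws" if "set hs \<subseteq> S" for hs
    using that
  proof (induction hs)
    case (Cons h hs)
    from Cons obtain ws where ws: "ws \<in> gwords V" "hs = map W.letter ws" by force
    from Cons.prems obtain a where "fst a \<in> V" "h = W.letter a" using S_letter[of h] by force
    with ws show ?case by (intro bexI[of _ "a # ws"]) simp_all
  qed (rule bexI[of _ "[]"]; simp)
  have "(\<exists>hs. set hs \<subseteq> S \<and> length hs = k \<and> foldr (\<otimes>\<^bsub>D\<^esub>) hs \<one>\<^bsub>D\<^esub> = g) \<longleftrightarrow>
      (\<exists>ws\<in>gwords V. W.eval ws = g \<and> length ws = k)" for k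
  proof
    assume "\<exists>hs. set hs \<subseteq> S \<and> length hs = k \<and> foldr (\<otimes>\<^bsub>D\<^esub>) hs \<one>\<^bsub>D\<^esub> = g"
    then obtain hs where hs: "set hs \<subseteq> S" "length hs = k" "foldr (\<otimes>\<^bsub>D\<^esub>) hs \<one>\<^bsub>D\<^esub> = g" by blast
    from from_S[OF hs(1)] obtain ws where "ws \<in> gwords V" "hs = map W.letter ws" by blast
    then show "\<exists>ws\<in>gwords V. W.eval ws = g \<and> length ws = k" using hs to[of ws] by (intro bexI[of _ ws]) simp_all
  next
    assume "\<exists>ws\<in>gwords V. W.eval ws = g \<and> length ws = k"
    then obtain ws where "ws \<in> gwords V" "W.eval ws = g" "length ws = k" by blast
    then show "\<exists>hs. set hs \<subseteq> S \<and> length hs = k \<and> foldr (\<otimes>\<^bsub>D\<^esub>) hs \<one>\<^bsub>D\<^esub> = g"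
      using to[of ws] by (intro exI[of _ "map W.letter ws"]) simp
  qed
  then show ?thesis unfolding word_length_def W.len_def S_def by presburger
qed

lemma growth_series_len_gf: "growth_series D (dyer_gens V E m f) = W.len_gf (W.par V)"
  by (simp add: growth_series_def W.len_gf_def word_length_len W.carrier_par)

end

theorem corollary1p2:
  fixes V :: "'a set" and E :: "'a set set" and m :: "'a set \<Rightarrow> nat" and f :: "'a \<Rightarrow> enat"
  assumes "dyer_graph V E m f"
  shows "\<exists>p q :: int poly. q \<noteq> 0 \<and>
    to_fract (growth_series (dyer_group V E m f) (dyer_gens V E m f)) =
      to_fract (fps_of_poly p) / to_fract (fps_of_poly q)"
proof -
  interpret dyer_graph V E m f by fact
  show ?thesis
    using W.rational_par[of V] unfolding growth_series_len_gf rational_fps_def by auto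
qed

end
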